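(* For $0<v\le x<v+a$ and $i,j\in E$, $$(F_a(x,v))_{ij}=\mathbb E_{(x,v),i}\big[e^{-w\tau_a};\tau_a<\infty,\ J(\tau_a)=j\big].$$ In particular $F_a(v,v)=H_a(v)$.
   Context: Model. Let $E=\{1,\dots,m\}$; for each $i\in E$ let $c_i>0$, $\lambda_i>0$, $p_i\in(0,1)$, and let $Q=(q_{ij})_{i,j\in E}$ be a stochastic matrix. $(X,J)$ is the Markov process on $[0,\infty)\times E$ with the following dynamics: while the phase $J$ equals $i$, the level $X$ increases linearly with slope $1/c_i$ and the next jump occurs at rate $\lambda_i$; at a jump from $(x,i)$ the process moves to $(p_i x,j)$ with probability $q_{ij}$ ($j=i$ is allowed). $e_i$ is the $i$-th canonical row vector. Fix $w>0$ and $a>0$. Given an initial running minimum $v>0$, let $\underline X_t=v\wedge\inf_{0\le s\le t}X(s)$, $Y_t=X(t)-\underline X_t$, $\tau_a=\inf\{t\ge0:Y_t\ge a\}$. $\mathbb E_{(x,v),i}$ denotes expectation given $X(0)=x$, $\underline X_0=v$, $J(0)=i$. For $v>0$ define the matrix $$(H_a(v))_{ij}=\mathbb E_{(v,v),i}\big[e^{-w\tau_a};\tau_a<\infty,\ J(\tau_a)=j\big].$$ For a bounded Borel $G:(0,\infty)\to\mathbb R^{m\times m}$ and $v>0$, $F_G(\cdot,v)$ denotes the bounded, absolutely continuous matrix function on $[v,v+a]$ with $F_G(v+a,v)=I$ which satisfies, for a.e. $x\in(v,v+a)$ and each $i\in E$, $$\frac1{c_i}\partial_x(e_iF_G(x,v))-(w+\lambda_i)e_iF_G(x,v)+\lambda_i\sum_kq_{ik}e_kG(p_ix)=0\quad\text{if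 }p_ix<v,$$ $$\frac1{c_i}\partial_x(e_iF_G(x,v))-(w+\lambda_i)e_iF_G(x,v)+\lambda_i\sum_kq_{ik}e_kF_G(p_ix,v)=0\quad\text{if }p_ix\ge v.$$ Such a function exists and is unique. Set $F_a=F_{H_a}$ (i.e. take $G=H_a$). *)

theory Defs
  imports "HOL-Probability.Probability"
begin

text \<open>
  The set of phases is a finite type \<open>'m\<close>. The parameters are the reciprocal slopes \<open>c\<close>, the
  jump rates \<open>lam\<close>, the contraction factors \<open>p\<close> and the transition matrix \<open>Q\<close>.
\<close>

definition stochastic_matrix :: "real ^ 'm ^ 'm \<Rightarrow> bool" where
  "stochastic_matrix Q \<longleftrightarrow> (\<forall>i j. 0 \<le> Q $ i $ j) \<and> (\<forall>i. (\<Sum>j\<in>UNIV. Q $ i $ j) = 1)"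


section \<open>The Markov process\<close>

text \<open>
  The process is realised on a product space: for every step \<open>n\<close> and every phase \<open>i\<close> there is
  a pair consisting of an exponential holding time with rate \<open>lam i\<close> and an independent next
  phase with law \<open>Q $ i\<close>, and all these pairs are independent. At step \<open>n\<close> only the pair that
  belongs to the current phase is used.
\<close>

type_synonym 'm noise = "nat \<Rightarrow> 'm \<Rightarrow> real \<times> 'm"

definition noise :: "('m::finite \<Rightarrow> real) \<Rightarrow> real ^ 'm ^ 'm \<Rightarrow> 'm noise measure" where
  "noise lam Q =
     (\<Pi>\<^sub>M n\<in>(UNIV :: nat set). \<Pi>\<^sub>M i\<in>(UNIV :: 'm set).
        density lborel (exponential_density (lam i))
          \<Otimes>\<^sub>M point_measure UNIV (\<lambda>j. ennreal (Q $ i $ j)))"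

text \<open>\<open>phase i \<omega> n\<close> is the phase after the \<open>n\<close>-th jump, and \<open>hold i \<omega> n\<close> the time spent in it.\<close>

primrec phase :: "'m \<Rightarrow> 'm noise \<Rightarrow> nat \<Rightarrow> 'm" where
  "phase i \<omega> 0 = i"
| "phase i \<omega> (Suc n) = snd (\<omega> n (phase i \<omega> n))"

definition hold :: "'m \<Rightarrow> 'm noise \<Rightarrow> nat \<Rightarrow> real" where
  "hold i \<omega> n = fst (\<omega> n (phase i \<omega> n))"

definition jump_time :: "'m \<Rightarrow> 'm noise \<Rightarrow> nat \<Rightarrow> real" where
  "jump_time i \<omega> n = (\<Sum>k<n. hold i \<omega> k)"

text \<open>The level immediately after the \<open>n\<close>-th jump:\<close>

primrec jump_level ::
  "('m \<Rightarrow> real) \<Rightarrow> ('m \<Rightarrow> real) \<Rightarrow> real \<Rightarrow> 'm \<Rightarrow> 'm noise \<Rightarrow> nat \<Rightarrow> real" where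
  "jump_level c p x i \<omega> 0 = x"
| "jump_level c p x i \<omega> (Suc n) =
     p (phase i \<omega> n) * (jump_level c p x i \<omega> n + hold i \<omega> n / c (phase i \<omega> n))"

text \<open>
  The number of jumps up to and including time \<open>t\<close>. The \<open>LEAST\<close> is unspecified only if no jump
  time exceeds \<open>t\<close>, that is, on the null event of an explosion.
\<close>

definition jumps :: "'m \<Rightarrow> 'm noise \<Rightarrow> real \<Rightarrow> nat" where
  "jumps i \<omega> t = (LEAST n. t < jump_time i \<omega> (Suc n))"

definition J_proc :: "'m \<Rightarrow> 'm noise \<Rightarrow> real \<Rightarrow> 'm" where
  "J_proc i \<omega> t = phase i \<omega> (jumps i \<omega> t)"

definition X_proc ::
  "('m \<Rightarrow> real) \<Rightarrow> ('m \<Rightarrow> real) \<Rightarrow> real \<Rightarrow> 'm \<Rightarrow> 'm noise \<Rightarrow> real \<Rightarrow> real" where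
  "X_proc c p x i \<omega> t =
     jump_level c p x i \<omega> (jumps i \<omega> t)
       + (t - jump_time i \<omega> (jumps i \<omega> t)) / c (J_proc i \<omega> t)"


section \<open>Passage of the process reflected at its running minimum\<close>

definition X_min ::
  "('m \<Rightarrow> real) \<Rightarrow> ('m \<Rightarrow> real) \<Rightarrow> real \<Rightarrow> real \<Rightarrow> 'm \<Rightarrow> 'm noise \<Rightarrow> real \<Rightarrow> real" where
  "X_min c p x v i \<omega> t = min v (INF s\<in>{0..t}. X_proc c p x i \<omega> s)"

definition Y_proc ::
  "('m \<Rightarrow> real) \<Rightarrow> ('m \<Rightarrow> real) \<Rightarrow> real \<Rightarrow> real \<Rightarrow> 'm \<Rightarrow> 'm noise \<Rightarrow> real \<Rightarrow> real" where
  "Y_proc c p x v i \<omega> t = X_proc c p x i \<omega> t - X_min c p x v i \<omega> t"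

definition tau ::
  "('m \<Rightarrow> real) \<Rightarrow> ('m \<Rightarrow> real) \<Rightarrow> real \<Rightarrow> real \<Rightarrow> real \<Rightarrow> 'm \<Rightarrow> 'm noise \<Rightarrow> ereal" where
  "tau c p a x v i \<omega> = (INF t\<in>{t. 0 \<le> t \<and> a \<le> Y_proc c p x v i \<omega> t}. ereal t)"

text \<open>
  The expectation of \<open>exp (- w * tau)\<close> on the event that \<open>tau\<close> is finite and the phase at \<open>tau\<close>
  is \<open>j\<close>, for the process started at level \<open>x\<close> in phase \<open>i\<close> with initial running minimum \<open>v\<close>.
  The integrand takes values in \<open>[0, 1]\<close>, so \<open>enn2real\<close> loses nothing.
\<close>

definition passage_transform ::
  "('m::finite \<Rightarrow> real) \<Rightarrow> ('m \<Rightarrow> real) \<Rightarrow> ('m \<Rightarrow> real) \<Rightarrow> real ^ 'm ^ 'm \<Rightarrow>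
     real \<Rightarrow> real \<Rightarrow> real \<Rightarrow> real \<Rightarrow> 'm \<Rightarrow> 'm \<Rightarrow> real" where
  "passage_transform c lam p Q w a x v i j =
     enn2real (\<integral>\<^sup>+ \<omega>. ennreal (exp (- w * real_of_ereal (tau c p a x v i \<omega>)))
         * indicator {\<omega>. tau c p a x v i \<omega> < \<infinity> \<and>
                         J_proc i \<omega> (real_of_ereal (tau c p a x v i \<omega>)) = j} \<omega>
       \<partial>noise lam Q)"

definition H_mat ::
  "('m::finite \<Rightarrow> real) \<Rightarrow> ('m \<Rightarrow> real) \<Rightarrow> ('m \<Rightarrow> real) \<Rightarrow> real ^ 'm ^ 'm \<Rightarrow>
     real \<Rightarrow> real \<Rightarrow> real \<Rightarrow> real ^ 'm ^ 'm" where
  "H_mat c lam p Q w a v = (\<chi> i j. passage_transform c lam p Q w a v v i j)"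


section \<open>The boundary value problem\<close>

definition absolutely_continuous_on_interval ::
  "real \<Rightarrow> real \<Rightarrow> (real \<Rightarrow> 'b::real_normed_vector) \<Rightarrow> bool" where
  "absolutely_continuous_on_interval l u f \<longleftrightarrow>
     (\<forall>\<epsilon>>0. \<exists>\<delta>>0. \<forall>D S. D division_of S \<longrightarrow> S \<subseteq> {l..u} \<longrightarrow>
        (\<Sum>K\<in>D. Sup K - Inf K) < \<delta> \<longrightarrow> (\<Sum>K\<in>D. norm (f (Sup K) - f (Inf K))) < \<epsilon>)"

text \<open>\<open>F x $ i\<close> is the \<open>i\<close>-th row of \<open>F x\<close>.\<close>

definition solves_bvp ::
  "('m::finite \<Rightarrow> real) \<Rightarrow> ('m \<Rightarrow> real) \<Rightarrow> ('m \<Rightarrow> real) \<Rightarrow> real ^ 'm ^ 'm \<Rightarrow>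
     real \<Rightarrow> real \<Rightarrow> (real \<Rightarrow> real ^ 'm ^ 'm) \<Rightarrow> real \<Rightarrow> (real \<Rightarrow> real ^ 'm ^ 'm) \<Rightarrow> bool" where
  "solves_bvp c lam p Q w a G v F \<longleftrightarrow>
     bounded (F ` {v..v + a}) \<and>
     absolutely_continuous_on_interval v (v + a) F \<and>
     F (v + a) = mat 1 \<and>
     (AE x in lborel. x \<in> {v<..<v + a} \<longrightarrow>
       (\<forall>i. \<exists>D. ((\<lambda>y. F y $ i) has_vector_derivative D) (at x) \<and>
          (1 / c i) *\<^sub>R D - (w + lam i) *\<^sub>R (F x $ i)
            + lam i *\<^sub>R (\<Sum>k\<in>UNIV. Q $ i $ k *\<^sub>R
                ((if p i * x < v then G (p i * x) else F (p i * x)) $ k)) = 0))"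

text \<open>The solution as a function on \<open>[v, v + a]\<close>, extended by \<open>undefined\<close>:\<close>

definition bvp_solution ::
  "('m::finite \<Rightarrow> real) \<Rightarrow> ('m \<Rightarrow> real) \<Rightarrow> ('m \<Rightarrow> real) \<Rightarrow> real ^ 'm ^ 'm \<Rightarrow>
     real \<Rightarrow> real \<Rightarrow> (real \<Rightarrow> real ^ 'm ^ 'm) \<Rightarrow> real \<Rightarrow> real \<Rightarrow> real ^ 'm ^ 'm" where
  "bvp_solution c lam p Q w a G x v =
     (THE F. F \<in> extensional {v..v + a} \<and> solves_bvp c lam p Q w a G v F) x"

definition F_mat ::
  "('m::finite \<Rightarrow> real) \<Rightarrow> ('m \<Rightarrow> real) \<Rightarrow> ('m \<Rightarrow> real) \<Rightarrow> real ^ 'm ^ 'm \<Rightarrow>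
     real \<Rightarrow> real \<Rightarrow> real \<Rightarrow> real \<Rightarrow> real ^ 'm ^ 'm" where
  "F_mat c lam p Q w a x v = bvp_solution c lam p Q w a (H_mat c lam p Q w a) x v"

end

theory Submission
  imports Defs
begin

text \<open>
  Conditioning on the first jump shows that the passage transform \<open>u\<close> satisfies \<open>u = T u\<close> on
  \<open>{(x, v). 0 < v \<le> x \<le> v + a}\<close> for an integral operator \<open>T\<close> that contracts the supremum norm by
  \<open>max lam i / (w + lam i) < 1\<close> and preserves joint continuity. Truncating the functional at the
  \<open>n\<close>-th jump produces exactly the Picard iterates \<open>T^n 0\<close>, so \<open>u\<close> is their uniform limit and hence
  continuous in \<open>(x, v)\<close>; in particular \<open>H_a\<close> is continuous. Therefore \<open>u\<close> is continuously
  differentiable in \<open>x\<close>, and differentiating \<open>u = T u\<close> gives the boundary value problem, even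
  everywhere instead of almost everywhere. Uniqueness for the boundary value problem follows from a
  maximum principle, using that an absolutely continuous function with almost everywhere
  nonnegative derivative is increasing.
\<close>

section \<open>Absolutely continuous functions\<close>

text \<open>The number \<open>lam i / (w + lam i)\<close> is the expectation of
  \<open>exp (- w * h)\<close> for an exponential time \<open>h\<close> of rate
  \<open>lam i\<close>, the discount collected up to one jump. Its maximum over the finitely many
  phases also bounds the Laplace transforms of the jump times, which rules out explosion.

  The running minimum has to be a second variable, because a jump to level \<open>x'\<close>
  restarts the process from the pair \<open>(x', min v x')\<close>. If \<open>x' < v\<close>, the
  new pair is on the diagonal and its value is an entry of \<open>H_a\<close>; otherwise
  \<open>v\<close> is kept and the value belongs to \<open>F_a(., v)\<close>. Both cases of the
  boundary value problem are thus one expression in \<open>u\<close>, and joint continuity of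
  \<open>u\<close> reaches \<open>H_a\<close> by restriction to the diagonal.

  On the probabilistic side the obstacle is that \<open>tau\<close> is an infimum over uncountably
  many times. Measurability of the passage functional is not attacked directly: on almost every path
  the functional is the supremum of the truncated functionals, which are measurable by recursion,
  and an almost sure identity is enough to equate the integrals.\<close>

lemma AC_subset:
  assumes "absolutely_continuous_on_interval l u f" "l \<le> l'" "u' \<le> u"
  shows "absolutely_continuous_on_interval l' u' f"
  using assms unfolding absolutely_continuous_on_interval_def
  by (meson atLeastatMost_subset_iff order_trans)

text \<open>Intervals of a division of a subset of \<open>{l..u}\<close> are nonempty, so their
  \<open>Inf\<close> and \<open>Sup\<close> lie in \<open>{l..u}\<close> and values elsewhere never
  enter. This serves functions that are extended arbitrarily beyond the interval.\<close>

lemma AC_cong: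
  assumes eq: "\<And>x. x \<in> {l..u} \<Longrightarrow> f x = g x" and f: "absolutely_continuous_on_interval l u f"
  shows "absolutely_continuous_on_interval l u g"
proof -
  have "(\<Sum>K\<in>D. norm (f (Sup K) - f (Inf K))) = (\<Sum>K\<in>D. norm (g (Sup K) - g (Inf K)))"
    if D: "D division_of S" "S \<subseteq> {l..u}" for D S
  proof (rule sum.cong[OF refl])
    fix K assume KD: "K \<in> D"
    obtain s t :: real where st: "K = cbox s t" using division_ofD(4)[OF D(1) KD] by blast
    have "K \<noteq> {}" "K \<subseteq> {l..u}" using division_ofD(2,3)[OF D(1) KD] D(2) by auto
    then have "s \<le> t" "s \<in> {l..u}" "t \<in> {l..u}" using st by (auto simp: subset_eq)
    then show "norm (f (Sup K) - f (Inf K)) = norm (g (Sup K) - g (Inf K))" using st by (simp add: eq)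
  qed
  with f show ?thesis unfolding absolutely_continuous_on_interval_def by (metis (no_types, lifting))
qed

lemma AC_diff:
  assumes "absolutely_continuous_on_interval l u f" "absolutely_continuous_on_interval l u g"
  shows "absolutely_continuous_on_interval l u (\<lambda>x. f x - g x)"
  unfolding absolutely_continuous_on_interval_def
proof (intro allI impI)
  fix e :: real assume "e > 0"
  then have "e / 2 > 0" by simp
  obtain d1 where d1: "d1 > 0" "\<And>D S. D division_of S \<Longrightarrow> S \<subseteq> {l..u} \<Longrightarrow>
        (\<Sum>K\<in>D. Sup K - Inf K) < d1 \<Longrightarrow> (\<Sum>K\<in>D. norm (f (Sup K) - f (Inf K))) < e / 2"
    using assms(1) \<open>e / 2 > 0\<close> unfolding absolutely_continuous_on_interval_def by meson
  obtain d2 where d2: "d2 > 0" "\<And>D S. D division_of S \<Longrightarrow> S \<subseteq> {l..u} \<Longrightarrow>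
        (\<Sum>K\<in>D. Sup K - Inf K) < d2 \<Longrightarrow> (\<Sum>K\<in>D. norm (g (Sup K) - g (Inf K))) < e / 2"
    using assms(2) \<open>e / 2 > 0\<close> unfolding absolutely_continuous_on_interval_def by meson
  show "\<exists>d>0. \<forall>D S. D division_of S \<longrightarrow> S \<subseteq> {l..u} \<longrightarrow> (\<Sum>K\<in>D. Sup K - Inf K) < d \<longrightarrow>
      (\<Sum>K\<in>D. norm (f (Sup K) - g (Sup K) - (f (Inf K) - g (Inf K)))) < e"
  proof (intro exI[of _ "min d1 d2"] conjI allI impI)
    fix D S assume D: "D division_of S" "S \<subseteq> {l..u}" "(\<Sum>K\<in>D. Sup K - Inf K) < min d1 d2"
    have "(\<Sum>K\<in>D. norm (f (Sup K) - g (Sup K) - (f (Inf K) - g (Inf K))))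
        \<le> (\<Sum>K\<in>D. norm (f (Sup K) - f (Inf K)) + norm (g (Sup K) - g (Inf K)))"
    proof (rule sum_mono)
      fix K
      have "f (Sup K) - g (Sup K) - (f (Inf K) - g (Inf K)) = (f (Sup K) - f (Inf K)) - (g (Sup K) - g (Inf K))"
        by simp
      then show "norm (f (Sup K) - g (Sup K) - (f (Inf K) - g (Inf K)))
          \<le> norm (f (Sup K) - f (Inf K)) + norm (g (Sup K) - g (Inf K))"
        by (metis norm_triangle_ineq4)
    qed
    also have "\<dots> < e"
      using d1(2)[OF D(1,2)] d2(2)[OF D(1,2)] D(3) by (simp add: sum.distrib)
    finally show "(\<Sum>K\<in>D. norm (f (Sup K) - g (Sup K) - (f (Inf K) - g (Inf K)))) < e" .
  qed (use d1 d2 in auto)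
qed

lemma AC_lipschitz_image:
  assumes "absolutely_continuous_on_interval l u f"
    and "\<And>x y. norm (h (f x) - h (f y)) \<le> norm (f x - f y)"
  shows "absolutely_continuous_on_interval l u (\<lambda>x. h (f x))"
  unfolding absolutely_continuous_on_interval_def
proof (intro allI impI)
  fix e :: real assume "e > 0"
  then obtain d where d: "d > 0" "\<And>D S. D division_of S \<Longrightarrow> S \<subseteq> {l..u} \<Longrightarrow>
        (\<Sum>K\<in>D. Sup K - Inf K) < d \<Longrightarrow> (\<Sum>K\<in>D. norm (f (Sup K) - f (Inf K))) < e"
    using assms(1) unfolding absolutely_continuous_on_interval_def by meson
  show "\<exists>d>0. \<forall>D S. D division_of S \<longrightarrow> S \<subseteq> {l..u} \<longrightarrow> (\<Sum>K\<in>D. Sup K - Inf K) < d \<longrightarrow>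
      (\<Sum>K\<in>D. norm (h (f (Sup K)) - h (f (Inf K)))) < e"
  proof (intro exI[of _ d] conjI allI impI)
    fix D S assume D: "D division_of S" "S \<subseteq> {l..u}" "(\<Sum>K\<in>D. Sup K - Inf K) < d"
    have "(\<Sum>K\<in>D. norm (h (f (Sup K)) - h (f (Inf K)))) \<le> (\<Sum>K\<in>D. norm (f (Sup K) - f (Inf K)))"
      by (intro sum_mono assms)
    also have "\<dots> < e" using d(2)[OF D] .
    finally show "(\<Sum>K\<in>D. norm (h (f (Sup K)) - h (f (Inf K)))) < e" .
  qed (use d in auto)
qed

lemma AC_lipschitz:
  fixes f :: "real \<Rightarrow> 'b::real_normed_vector"
  assumes L: "\<And>x y. x \<in> {l..u} \<Longrightarrow> y \<in> {l..u} \<Longrightarrow> x \<le> y \<Longrightarrow> norm (f y - f x) \<le> L * (y - x)"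
  shows "absolutely_continuous_on_interval l u f"
  unfolding absolutely_continuous_on_interval_def
proof (intro allI impI)
  fix e :: real assume "e > 0"
  \<comment> \<open>No sign is assumed for \<open>L\<close>; \<open>\<bar>L\<bar> + 1\<close> is a
    positive constant that dominates it.\<close>
  define d where "d = e / (\<bar>L\<bar> + 1)"
  show "\<exists>d>0. \<forall>D S. D division_of S \<longrightarrow> S \<subseteq> {l..u} \<longrightarrow> (\<Sum>K\<in>D. Sup K - Inf K) < d \<longrightarrow>
      (\<Sum>K\<in>D. norm (f (Sup K) - f (Inf K))) < e"
  proof (intro exI[of _ d] conjI allI impI)
    show "d > 0" using \<open>e > 0\<close> by (simp add: d_def divide_pos_pos)
    fix D S assume D: "D division_of S" "S \<subseteq> {l..u}" "(\<Sum>K\<in>D. Sup K - Inf K) < d"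
    have K: "norm (f (Sup K) - f (Inf K)) \<le> (\<bar>L\<bar> + 1) * (Sup K - Inf K)" if KD: "K \<in> D" for K
    proof -
      obtain s t :: real where st: "K = cbox s t" using division_ofD(4)[OF D(1) KD] by blast
      have "K \<noteq> {}" "K \<subseteq> {l..u}" using division_ofD(2,3)[OF D(1) KD] D(2) by auto
      then have "s \<le> t" "s \<in> {l..u}" "t \<in> {l..u}" using st by (auto simp: subset_eq)
      then have "norm (f t - f s) \<le> L * (t - s)" by (intro L)
      also have "\<dots> \<le> (\<bar>L\<bar> + 1) * (t - s)" using \<open>s \<le> t\<close> by (intro mult_right_mono) auto
      finally show ?thesis using st \<open>s \<le> t\<close> by simp
    qed
    have "(\<Sum>K\<in>D. norm (f (Sup K) - f (Inf K))) \<le> (\<bar>L\<bar> + 1) * (\<Sum>K\<in>D. Sup K - Inf K)"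
      unfolding sum_distrib_left by (intro sum_mono K)
    also have "\<dots> < (\<bar>L\<bar> + 1) * d" using D(3) by (intro mult_strict_left_mono) auto
    also have "\<dots> = e" by (simp add: d_def)
    finally show "(\<Sum>K\<in>D. norm (f (Sup K) - f (Inf K))) < e" .
  qed
qed

lemma AC_imp_continuous_on:
  fixes f :: "real \<Rightarrow> 'b::real_normed_vector"
  assumes "absolutely_continuous_on_interval l u f"
  shows "continuous_on {l..u} f"
  unfolding continuous_on_iff
proof (intro ballI allI impI)
  fix x e :: real assume x: "x \<in> {l..u}" and "e > 0"
  then obtain d where d: "d > 0" "\<And>D S. D division_of S \<Longrightarrow> S \<subseteq> {l..u} \<Longrightarrow>
        (\<Sum>K\<in>D. Sup K - Inf K) < d \<Longrightarrow> (\<Sum>K\<in>D. norm (f (Sup K) - f (Inf K))) < e"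
    using assms unfolding absolutely_continuous_on_interval_def by meson
  have "dist (f x') (f x) < e" if "x' \<in> {l..u}" "dist x' x < d" for x'
  proof -
    define s t where "s = min x x'" and "t = max x x'"
    have st: "s \<le> t" "{s..t} \<subseteq> {l..u}" "t - s < d"
      using x that by (auto simp: s_def t_def dist_real_def)
    have "{{s..t}} division_of {s..t}" using st(1) by (intro division_of_self[of s t, simplified]) auto
    from d(2)[OF this st(2)] st have "norm (f t - f s) < e" by simp
    then show ?thesis by (auto simp: s_def t_def dist_norm norm_minus_commute min_def max_def split: if_splits)
  qed
  with d(1) show "\<exists>d>0. \<forall>x'\<in>{l..u}. dist x' x < d \<longrightarrow> dist (f x') (f x) < e" by auto
qed

text \<open>A gauge that is adapted to the derivative at the good points and to a small open neighbourhood of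
  the exceptional null set: on the intervals tagged in the latter, absolute continuity bounds the
  total variation.\<close>

lemma AC_deriv_nonneg_imp_le:
  fixes f :: "real \<Rightarrow> real"
  assumes AC: "absolutely_continuous_on_interval l u f" and "l \<le> u"
    and ae: "AE x in lborel. x \<in> {l<..<u} \<longrightarrow> (\<exists>D\<ge>0. (f has_real_derivative D) (at x))"
  shows "f l \<le> f u"
proof (rule field_le_epsilon)
  fix e' :: real assume "e' > 0"
  \<comment> \<open>The intervals with good tags lose at most \<open>e * (u - l)\<close> and those
    with bad tags at most \<open>e\<close>, together \<open>e'\<close>.\<close>
  define e where "e = e' / (1 + (u - l))"
  have "e > 0" using \<open>e' > 0\<close> \<open>l \<le> u\<close> by (simp add: e_def)
  obtain d where d: "d > 0" "\<And>D S. D division_of S \<Longrightarrow> S \<subseteq> {l..u} \<Longrightarrow>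
        (\<Sum>K\<in>D. Sup K - Inf K) < d \<Longrightarrow> (\<Sum>K\<in>D. norm (f (Sup K) - f (Inf K))) < e"
    using AC \<open>e > 0\<close> unfolding absolutely_continuous_on_interval_def by meson
  define good where "good x \<longleftrightarrow> x \<in> {l<..<u} \<and> (\<exists>D\<ge>0. (f has_real_derivative D) (at x))" for x
  obtain N where N: "N \<in> null_sets lborel" "\<And>x. x \<notin> N \<Longrightarrow> x \<in> {l<..<u} \<Longrightarrow> good x"
    using ae unfolding good_def eventually_ae_filter by (auto simp: subset_eq) blast
  \<comment> \<open>The endpoints join the null set because \<open>good\<close> is confined to the
    open interval, whereas tags may be endpoints.\<close>
  have "negligible (N \<union> {l, u})"
    using N(1) by (auto simp: negligible_iff_null_sets null_sets_completionI)
  then have N': "N \<union> {l, u} \<in> lmeasurable" "measure lebesgue (N \<union> {l, u}) = 0"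
    by (auto simp: negligible_iff_measure)
  obtain U where U: "open U" "N \<union> {l, u} \<subseteq> U" "U \<in> lmeasurable" "measure lebesgue U < d"
  proof -
    let ?N = "N \<union> {l, u}"
    obtain T where T: "open T" "?N \<subseteq> T" "T - ?N \<in> lmeasurable" "emeasure lebesgue (T - ?N) < ennreal d"
      using sets_lebesgue_outer_open[OF fmeasurableD[OF N'(1)] d(1)] by blast
    have eq: "T = ?N \<union> (T - ?N)" using T(2) by blast
    have "T \<in> lmeasurable" using fmeasurable.Un[OF N'(1) T(3)] eq by simp
    have "measure lebesgue T \<le> measure lebesgue ?N + measure lebesgue (T - ?N)"
      using measure_Un_le[of ?N lebesgue "T - ?N"] N'(1) T(3) eq by (metis fmeasurableD)
    also have "\<dots> < d"
      using T(3,4) d(1) N'(2) by (simp add: emeasure_eq_measure2 ennreal_less_iff)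
    finally show thesis using that T \<open>T \<in> lmeasurable\<close> by blast
  qed
  \<comment> \<open>Straddle estimate: lower bounds on either side of the tag \<open>x\<close>. For
    an interval \<open>{s..t}\<close> around \<open>x\<close> their sum eliminates
    \<open>f x\<close> and leaves a bound for \<open>f t - f s\<close>.\<close>
  have "\<exists>r>0. \<forall>y. \<bar>y - x\<bar> < r \<longrightarrow> (x \<le> y \<longrightarrow> f y - f x \<ge> - e * (y - x)) \<and>
      (y \<le> x \<longrightarrow> f x - f y \<ge> - e * (x - y))" if gx: "good x" for x
  proof -
    obtain D where D0: "D \<ge> 0" "(f has_real_derivative D) (at x)"
      using gx unfolding good_def by blast
    then have D: "D \<ge> 0" "(f has_derivative (*) D) (at x)"
      by (simp_all add: has_field_derivative_def)
    obtain r where r: "r > 0" "\<And>y. norm (y - x) < r \<Longrightarrow> norm (f y - f x - D * (y - x)) \<le> e * norm (y - x)"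
      using D(2) \<open>e > 0\<close> unfolding has_derivative_at_alt by blast
    show ?thesis
    proof (intro exI[of _ r] conjI allI impI)
      fix y assume y: "\<bar>y - x\<bar> < r" "x \<le> y"
      moreover have "0 \<le> D * (y - x)" using y D(1) by simp
      ultimately show "- e * (y - x) \<le> f y - f x" using r(2)[of y] by (auto simp: abs_le_iff)
    next
      fix y assume y: "\<bar>y - x\<bar> < r" "y \<le> x"
      moreover have "D * (y - x) \<le> 0" using y D(1) by (simp add: mult_nonneg_nonpos)
      ultimately show "- e * (x - y) \<le> f x - f y" using r(2)[of y] by (auto simp: abs_le_iff algebra_simps)
    qed (use r in auto)
  qed
  then obtain r where r: "\<And>x. good x \<Longrightarrow> r x > 0"
    "\<And>x y. good x \<Longrightarrow> \<bar>y - x\<bar> < r x \<Longrightarrow> x \<le> y \<Longrightarrow> f y - f x \<ge> - e * (y - x)"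
    "\<And>x y. good x \<Longrightarrow> \<bar>y - x\<bar> < r x \<Longrightarrow> y \<le> x \<Longrightarrow> f x - f y \<ge> - e * (x - y)"
    by metis
  \<comment> \<open>Every point of \<open>{l..u}\<close> is good or lies in \<open>U\<close>. The
    value \<open>ball x 1\<close> occurs only at other points and makes \<open>\<gamma>\<close> a
    gauge on the whole line.\<close>
  define \<gamma> where "\<gamma> x = (if good x then ball x (r x) else if x \<in> U then U else ball x 1)" for x
  have "gauge \<gamma>" using U(1) r(1) by (auto simp: gauge_def \<gamma>_def)
  then obtain p where p: "p tagged_division_of {l..u}" "\<gamma> fine p"
    using fine_division_exists_real by blast
  have fin: "finite p" using p(1) by (rule tagged_division_of_finite)
  have K: "\<exists>s t. K = {s..t} \<and> s \<le> t \<and> x \<in> {s..t} \<and> K \<subseteq> {l..u} \<and> K \<subseteq> \<gamma> x"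
    if xK: "(x, K) \<in> p" for x K
  proof -
    obtain s t :: real where st: "K = {s..t}"
      using tagged_division_ofD(4)[OF p(1) xK] by (auto simp: cbox_interval)
    then show ?thesis
      using tagged_division_ofD(2,3)[OF p(1) xK] fineD[OF p(2) xK] by (intro exI[of _ s] exI[of _ t]) auto
  qed
  \<comment> \<open>The badly tagged intervals. They lie in \<open>U\<close>, so their total length
    is below the \<open>d\<close> of absolute continuity.\<close>
  define q where "q = {(x, K) \<in> p. \<not> good x}"
  have qp: "q \<subseteq> p" by (auto simp: q_def)
  have q: "q tagged_partial_division_of {l..u}"
    by (rule tagged_partial_division_subset[OF conjunct1[OF p(1)[unfolded tagged_division_of_def]] qp])
  note q' = tagged_partial_division_of_Union_self[OF q]
  have div: "snd ` q division_of \<Union>(snd ` q)" by (rule division_of_tagged_division[OF q'])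
  have inU: "K \<subseteq> U" if "(x, K) \<in> q" for x K
  proof -
    have xK: "(x, K) \<in> p" "\<not> good x" using that by (auto simp: q_def)
    then have "x \<in> {l..u}" "K \<subseteq> \<gamma> x" using K[OF xK(1)] by auto
    then have "x \<in> U" using N(2)[of x] xK(2) U(2)
      by (cases "x = l"; cases "x = u"; cases "x \<in> N") auto
    then show ?thesis using \<open>K \<subseteq> \<gamma> x\<close> xK(2) by (simp add: \<gamma>_def)
  qed
  have len: "Sup K - Inf K = measure lebesgue K" "K \<subseteq> {l..u}" if xK: "(x, K) \<in> q" for x K
    using K[OF subsetD[OF qp xK]] by (auto simp: measure_completion)
  \<comment> \<open>Used to pass from a sum over intervals to a sum over tagged intervals. That step
    requires a summand vanishing on every box with empty interior; such a box may be empty, and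
    \<open>Sup\<close> and \<open>Inf\<close> of the empty set are of no use there.\<close>
  let ?g = "\<lambda>K. if K = {} then 0 else norm (f (Sup K) - f (Inf K))"
  have "(\<Sum>K\<in>snd ` q. norm (f (Sup K) - f (Inf K))) < e"
  proof (rule d(2)[OF div])
    show "\<Union>(snd ` q) \<subseteq> {l..u}" by (metis Union_least imageE len(2) prod.collapse)
    have "(\<Sum>K\<in>snd ` q. Sup K - Inf K) = (\<Sum>K\<in>snd ` q. measure lebesgue K)"
      using len(1) by (intro sum.cong refl) auto
    also have "\<dots> = measure lebesgue (\<Union>(snd ` q))" by (rule content_division[OF div])
    also have "\<dots> \<le> measure lebesgue U"
    proof (rule measure_mono_fmeasurable)
      show "\<Union>(snd ` q) \<subseteq> U" by (metis Union_least imageE inU prod.collapse)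
    qed (use U lmeasurable_division[OF div] in \<open>auto intro: fmeasurableD\<close>)
    finally show "(\<Sum>K\<in>snd ` q. Sup K - Inf K) < d" using U(4) by simp
  qed
  also have "(\<Sum>K\<in>snd ` q. norm (f (Sup K) - f (Inf K))) = (\<Sum>K\<in>snd ` q. ?g K)"
    using division_ofD(3)[OF div] by (intro sum.cong) auto
  also have "\<dots> = (\<Sum>(x,K)\<in>q. ?g K)"
  proof (rule sum.over_tagged_division_lemma[OF q', symmetric])
    fix s t :: real assume "box s t = {}"
    then have "t \<le> s" by auto
    then show "?g (cbox s t) = 0"
      by (cases "s = t") auto
  qed
  also have "\<dots> = (\<Sum>(x,K)\<in>q. norm (f (Sup K) - f (Inf K)))"
    by (intro sum.cong) (auto dest: tagged_division_ofD(2)[OF q'])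
  finally have Q: "(\<Sum>(x,K)\<in>q. norm (f (Sup K) - f (Inf K))) < e" .
  have "f u - f l = (\<Sum>(x,K)\<in>p. f (Sup K) - f (Inf K))"
    using additive_tagged_division_1[OF \<open>l \<le> u\<close> p(1), of f] by simp
  also have "\<dots> = (\<Sum>(x,K)\<in>p - q. f (Sup K) - f (Inf K)) + (\<Sum>(x,K)\<in>q. f (Sup K) - f (Inf K))"
    using fin qp by (simp add: sum.subset_diff)
  also have "\<dots> \<ge> - e * (u - l) + - e"
  proof (rule add_mono)
    have "(\<Sum>(x,K)\<in>q. - (f (Sup K) - f (Inf K))) \<le> (\<Sum>(x,K)\<in>q. norm (f (Sup K) - f (Inf K)))"
      by (intro sum_mono) auto
    with Q show "- e \<le> (\<Sum>(x,K)\<in>q. f (Sup K) - f (Inf K))"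
      unfolding case_prod_unfold by (simp only: sum_negf)
    have "- e * (u - l) = - e * (\<Sum>(x,K)\<in>p. measure lborel K)"
      using additive_content_tagged_division[of p l u] p(1) \<open>l \<le> u\<close> by (simp add: cbox_interval)
    \<comment> \<open>Omitting nonnegative lengths increases a sum multiplied by
      \<open>- e\<close>.\<close>
    also have "\<dots> \<le> - e * (\<Sum>(x,K)\<in>p - q. measure lborel K)"
      using \<open>e > 0\<close> fin qp
      by (intro mult_left_mono_neg sum_mono2) (auto simp: case_prod_unfold)
    also have "\<dots> = (\<Sum>(x,K)\<in>p - q. - e * measure lborel K)"
      by (simp add: sum_distrib_left case_prod_unfold sum_negf)
    also have "\<dots> \<le> (\<Sum>(x,K)\<in>p - q. f (Sup K) - f (Inf K))"
    proof (intro sum_mono, clarify)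
      fix x K assume xK: "(x, K) \<in> p" "(x, K) \<notin> q"
      then have g: "good x" by (auto simp: q_def)
      obtain s t where st: "K = {s..t}" "s \<le> t" "x \<in> {s..t}" "K \<subseteq> \<gamma> x" using K[OF xK(1)] by blast
      have "s \<in> \<gamma> x" "t \<in> \<gamma> x" using st by auto
      then have "\<bar>s - x\<bar> < r x" "\<bar>t - x\<bar> < r x" using g by (auto simp: \<gamma>_def dist_real_def)
      then have "- e * (t - x) \<le> f t - f x" "- e * (x - s) \<le> f x - f s"
        using r(2)[OF g, of t] r(3)[OF g, of s] st by auto
      then have "- e * (t - s) \<le> f t - f s" by (simp add: algebra_simps)
      then show "- e * measure lborel K \<le> f (Sup K) - f (Inf K)" using st by simp
    qed
    finally show "- e * (u - l) \<le> (\<Sum>(x,K)\<in>p - q. f (Sup K) - f (Inf K))" .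
  qed
  finally have "f l \<le> f u + e * (1 + (u - l))" by (simp add: algebra_simps)
  also have "e * (1 + (u - l)) = e'" using \<open>l \<le> u\<close> by (simp add: e_def)
  finally show "f l \<le> f u + e'" .
qed


section \<open>Uniqueness for the boundary value problem\<close>

locale drop_process =
  fixes c lam p :: "'m::finite \<Rightarrow> real" and Q :: "real ^ 'm ^ 'm" and w a :: real
  assumes c_pos: "\<And>i. c i > 0" and lam_pos: "\<And>i. lam i > 0"
    and p_bounds: "\<And>i. 0 < p i \<and> p i < 1"
    and Q_stochastic: "stochastic_matrix Q"
    and w_pos: "w > 0" and a_pos: "a > 0"
begin

lemma p_pos: "0 < p i" and p_less_1: "p i < 1"
  using p_bounds by auto

lemma Q_nonneg: "0 \<le> Q $ i $ j" and Q_sum: "(\<Sum>j\<in>UNIV. Q $ i $ j) = 1"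
  using Q_stochastic by (auto simp: stochastic_matrix_def)

lemma p_mult_less: "0 < x \<Longrightarrow> p i * x < x"
  using mult_strict_right_mono[OF p_less_1, of x i] by simp

lemma Q_average_le:
  assumes "\<And>k. f k \<le> M"
  shows "(\<Sum>k\<in>UNIV. Q $ i $ k * f k) \<le> M"
proof -
  have "(\<Sum>k\<in>UNIV. Q $ i $ k * f k) \<le> (\<Sum>k\<in>UNIV. Q $ i $ k * M)"
    using assms by (intro sum_mono mult_left_mono Q_nonneg)
  also have "\<dots> = M" by (simp add: sum_distrib_right[symmetric] Q_sum)
  finally show ?thesis .
qed

text \<open>Just to the right of a positive maximum of the difference \<open>D\<close> of the two solutions, the term
  \<open>(w + lam i) * D\<close> dominates the jump term, so \<open>D\<close> would still increase.\<close>

lemma bvp_solution_le: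
  assumes F1: "solves_bvp c lam p Q w a G v F1" and F2: "solves_bvp c lam p Q w a G v F2"
    and v: "v > 0" and x: "x \<in> {v..v + a}"
  shows "F1 x $ i $ j \<le> F2 x $ i $ j"
proof (rule ccontr)
  assume less: "\<not> F1 x $ i $ j \<le> F2 x $ i $ j"
  define D where "D k y = F1 y $ k $ j - F2 y $ k $ j" for k y
  have AC: "absolutely_continuous_on_interval v (v + a) (D k)" for k
  proof -
    have "absolutely_continuous_on_interval v (v + a) (\<lambda>y. F1 y - F2 y)"
      using F1 F2 by (intro AC_diff) (auto simp: solves_bvp_def)
    moreover have "norm (A $ k $ j - B $ k $ j) \<le> norm (A - B)" for A B :: "real ^ 'm ^ 'm"
      by (metis component_le_norm_cart Finite_Cartesian_Product.norm_nth_le order_trans real_norm_def vector_minus_component)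
    ultimately have "absolutely_continuous_on_interval v (v + a) (\<lambda>y. (F1 y - F2 y) $ k $ j)"
      by (rule AC_lipschitz_image[where h = "\<lambda>A. A $ k $ j"])
    then show ?thesis by (simp add: D_def[abs_def])
  qed
  have cont: "continuous_on {v..v + a} (D k)" for k
    by (rule AC_imp_continuous_on[OF AC])
  have "\<exists>y\<in>{v..v + a}. \<forall>z\<in>{v..v + a}. D k z \<le> D k y" for k
    using a_pos by (intro continuous_attains_sup cont) auto
  then obtain y where y: "\<And>k. y k \<in> {v..v + a}" "\<And>k z. z \<in> {v..v + a} \<Longrightarrow> D k z \<le> D k (y k)"
    by metis
  \<comment> \<open>The maximum is taken over phases as well as levels, because the jump term of row
    \<open>m\<close> averages \<open>D k\<close> over all phases \<open>k\<close>.\<close>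
  obtain m where m: "\<And>k. D k (y k) \<le> D m (y m)"
  proof -
    have "Max (range (\<lambda>k. D k (y k))) \<in> range (\<lambda>k. D k (y k))" by (intro Max_in) auto
    then obtain m where "Max (range (\<lambda>k. D k (y k))) = D m (y m)" by (metis imageE)
    then show thesis using that by (metis Max_ge finite finite_imageI rangeI)
  qed
  define x0 M where "x0 = y m" and "M = D m x0"
  have x0: "x0 \<in> {v..v + a}" and le_M: "z \<in> {v..v + a} \<Longrightarrow> D k z \<le> M" for k z
    unfolding x0_def M_def using y(1)[of m] order_trans[OF y(2)[of z k] m[of k]] by auto
  have "M > 0" using le_M[OF x, of i] less by (auto simp: D_def)
  moreover have "D m (v + a) = 0" using F1 F2 by (auto simp: D_def solves_bvp_def)
  ultimately have "x0 < v + a" using x0 by (cases "x0 = v + a") (auto simp: M_def)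
  \<comment> \<open>The threshold is chosen so that \<open>D m z\<close> above it gives
    \<open>(w + lam m) * D m z - lam m * M > (w / 2) * M\<close>. Half of the killing rate
    \<open>w\<close> then survives as a lower bound for the derivative, namely
    \<open>c m * (w / 2) * M\<close>, which is \<open>\<eta>\<close> below.\<close>
  have "M * (w / 2 + lam m) / (w + lam m) < M"
    using w_pos lam_pos[of m] \<open>M > 0\<close> by (simp add: field_simps)
  then obtain r where r: "r > 0"
    "\<And>z. z \<in> {v..v + a} \<Longrightarrow> dist z x0 < r \<Longrightarrow> dist (D m z) (D m x0) < M - M * (w / 2 + lam m) / (w + lam m)"
    using cont[of m] x0 unfolding continuous_on_iff by (metis diff_gt_0_iff_gt)
  define u where "u = min (v + a) (x0 + r / 2)"
  have u: "x0 < u" "u \<le> v + a" "u < x0 + r" using \<open>x0 < v + a\<close> r by (auto simp: u_def)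
  have big: "M * (w / 2 + lam m) < (w + lam m) * D m z" if "z \<in> {x0..u}" for z
  proof -
    have "D m z > M * (w / 2 + lam m) / (w + lam m)"
      using r(2)[of z] that x0 u by (auto simp: M_def dist_real_def)
    then show ?thesis using w_pos lam_pos[of m] by (simp add: field_simps)
  qed
  define \<eta> where "\<eta> = c m * (w / 2) * M"
  have "\<eta> > 0" using c_pos w_pos \<open>M > 0\<close> by (simp add: \<eta>_def)
  have "D m x0 - \<eta> * x0 \<le> D m u - \<eta> * u"
  proof (rule AC_deriv_nonneg_imp_le[of x0 u "\<lambda>z. D m z - \<eta> * z"])
    show "absolutely_continuous_on_interval x0 u (\<lambda>z. D m z - \<eta> * z)"
    proof (rule AC_diff)
      show "absolutely_continuous_on_interval x0 u (D m)" using AC_subset[OF AC] x0 u by auto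
      show "absolutely_continuous_on_interval x0 u ((*) \<eta>)"
        using \<open>\<eta> > 0\<close> by (intro AC_lipschitz[where L = \<eta>]) (simp add: right_diff_distrib[symmetric] abs_mult)
    qed
    have "AE z in lborel. z \<in> {v<..<v + a} \<longrightarrow>
       (\<forall>i. \<exists>D. ((\<lambda>y. F1 y $ i) has_vector_derivative D) (at z) \<and>
          (1 / c i) *\<^sub>R D - (w + lam i) *\<^sub>R (F1 z $ i)
            + lam i *\<^sub>R (\<Sum>k\<in>UNIV. Q $ i $ k *\<^sub>R
                ((if p i * z < v then G (p i * z) else F1 (p i * z)) $ k)) = 0)"
      using F1 by (simp add: solves_bvp_def)
    moreover have "AE z in lborel. z \<in> {v<..<v + a} \<longrightarrow>
       (\<forall>i. \<exists>D. ((\<lambda>y. F2 y $ i) has_vector_derivative D) (at z) \<and>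
          (1 / c i) *\<^sub>R D - (w + lam i) *\<^sub>R (F2 z $ i)
            + lam i *\<^sub>R (\<Sum>k\<in>UNIV. Q $ i $ k *\<^sub>R
                ((if p i * z < v then G (p i * z) else F2 (p i * z)) $ k)) = 0)"
      using F2 by (simp add: solves_bvp_def)
    ultimately show "AE z in lborel. z \<in> {x0<..<u} \<longrightarrow>
       (\<exists>d\<ge>0. ((\<lambda>z. D m z - \<eta> * z) has_real_derivative d) (at z))"
    proof eventually_elim
      case (elim z)
      show ?case
      proof
        assume z: "z \<in> {x0<..<u}"
        then have zv: "z \<in> {v<..<v + a}" using x0 u by auto
        let ?G = "\<lambda>F k. (if p m * z < v then G (p m * z) else F (p m * z)) $ k"
        obtain D1 D2 where
          D1: "((\<lambda>y. F1 y $ m) has_vector_derivative D1) (at z)"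
            "(1 / c m) *\<^sub>R D1 - (w + lam m) *\<^sub>R (F1 z $ m) + lam m *\<^sub>R (\<Sum>k\<in>UNIV. Q $ m $ k *\<^sub>R ?G F1 k) = 0" and
          D2: "((\<lambda>y. F2 y $ m) has_vector_derivative D2) (at z)"
            "(1 / c m) *\<^sub>R D2 - (w + lam m) *\<^sub>R (F2 z $ m) + lam m *\<^sub>R (\<Sum>k\<in>UNIV. Q $ m $ k *\<^sub>R ?G F2 k) = 0"
          using elim zv by meson
        have deriv: "((\<lambda>y. F1 y $ m $ j) has_real_derivative D1 $ j) (at z)"
             "((\<lambda>y. F2 y $ m $ j) has_real_derivative D2 $ j) (at z)"
          using bounded_linear.has_vector_derivative[OF bounded_linear_vec_nth, OF D1(1)]
            bounded_linear.has_vector_derivative[OF bounded_linear_vec_nth, OF D2(1)]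
          by (auto simp: has_real_derivative_iff_has_vector_derivative)
        define S where "S = (\<Sum>k\<in>UNIV. Q $ m $ k * (?G F1 k $ j - ?G F2 k $ j))"
        have 1: "D1 $ j / c m - (w + lam m) * (F1 z $ m $ j) + lam m * (\<Sum>k\<in>UNIV. Q $ m $ k * ?G F1 k $ j) = 0"
          using arg_cong[OF D1(2), of "\<lambda>r. r $ j"] by (simp add: sum_component)
        have 2: "D2 $ j / c m - (w + lam m) * (F2 z $ m $ j) + lam m * (\<Sum>k\<in>UNIV. Q $ m $ k * ?G F2 k $ j) = 0"
          using arg_cong[OF D2(2), of "\<lambda>r. r $ j"] by (simp add: sum_component)
        have "(D1 $ j - D2 $ j) / c m = (w + lam m) * D m z - lam m * S"
          using 1 2 by (simp add: S_def D_def right_diff_distrib sum_subtractf diff_divide_distrib)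
        then have eq: "D1 $ j - D2 $ j = c m * ((w + lam m) * D m z - lam m * S)"
          using c_pos[of m] by (simp add: field_simps)
        \<comment> \<open>If the jump leads below \<open>v\<close>, both solutions use the same
          \<open>G\<close> and the difference is 0, which is at most \<open>M\<close> since
          \<open>M > 0\<close>. Otherwise \<open>p m * z\<close> stays in the interval and
          maximality of \<open>M\<close> applies.\<close>
        have "S \<le> M" unfolding S_def
        proof (rule Q_average_le)
          fix k
          have "p m * z \<in> {v..v + a}" if "\<not> p m * z < v"
          proof -
            have "0 < z" "v \<le> p m * z" "z < v + a" using that zv v by auto
            moreover from this(1) have "p m * z < z" by (rule p_mult_less)
            ultimately have "v \<le> p m * z" "p m * z \<le> v + a" by linarith+
            then show ?thesis by simp
          qed
          then show "?G F1 k $ j - ?G F2 k $ j \<le> M"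
            using le_M[of "p m * z" k] \<open>M > 0\<close> by (auto simp: D_def)
        qed
        then have "lam m * S \<le> lam m * M" using lam_pos[of m] by simp
        with big[of z] z have "(w / 2) * M \<le> (w + lam m) * D m z - lam m * S"
          by (auto simp: algebra_simps)
        then have "\<eta> \<le> D1 $ j - D2 $ j"
          unfolding eq \<eta>_def mult.assoc using c_pos[of m] by (intro mult_left_mono) auto
        moreover have "((\<lambda>z. D m z - \<eta> * z) has_real_derivative (D1 $ j - D2 $ j) - \<eta>) (at z)"
          unfolding D_def by (auto intro!: derivative_eq_intros deriv)
        ultimately show "\<exists>d\<ge>0. ((\<lambda>z. D m z - \<eta> * z) has_real_derivative d) (at z)"
          by (intro exI[of _ "(D1 $ j - D2 $ j) - \<eta>"]) auto
      qed
    qed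
  qed (use u in auto)
  then have "M + \<eta> * (u - x0) \<le> D m u" by (simp add: M_def algebra_simps)
  moreover have "\<eta> * (u - x0) > 0" using \<open>\<eta> > 0\<close> u by simp
  moreover have "D m u \<le> M" using le_M u x0 by auto
  ultimately show False by simp
qed

end

section \<open>Decomposition of a path at its first jump\<close>

text \<open>\<open>case_nat y \<omega>\<close> is the noise sequence with first step
  \<open>y\<close> and continuation \<open>\<omega>\<close>. Only the pair \<open>y i\<close> of the
  initial phase is read, so the rest of the path is the path of \<open>\<omega>\<close> started in
  \<open>snd (y i)\<close>.\<close>

lemma phase_case_nat_Suc: "phase i (case_nat y \<omega>) (Suc n) = phase (snd (y i)) \<omega> n"
  by (induction n) auto

lemma hold_case_nat_0: "hold i (case_nat y \<omega>) 0 = fst (y i)"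
  by (simp add: hold_def)

lemma hold_case_nat_Suc: "hold i (case_nat y \<omega>) (Suc n) = hold (snd (y i)) \<omega> n"
  unfolding hold_def phase_case_nat_Suc by simp

lemma jump_time_case_nat_Suc:
  "jump_time i (case_nat y \<omega>) (Suc n) = fst (y i) + jump_time (snd (y i)) \<omega> n"
  by (simp add: jump_time_def sum.lessThan_Suc_shift hold_case_nat_0 hold_case_nat_Suc del: sum.lessThan_Suc)

lemma jump_level_case_nat_Suc:
  "jump_level c p x i (case_nat y \<omega>) (Suc n)
     = jump_level c p (p i * (x + fst (y i) / c i)) (snd (y i)) \<omega> n"
proof (induction n)
  case 0
  then show ?case by (simp add: hold_case_nat_0)
next
  case (Suc n)
  then show ?case
    unfolding jump_level.simps(2)[of c p x i "case_nat y \<omega>" "Suc n"]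
    by (simp add: phase_case_nat_Suc hold_case_nat_Suc del: phase.simps(2) jump_level.simps(2))
       (simp add: jump_level.simps(2))
qed

text \<open>Unbounded jump times exclude explosion, so that the \<open>LEAST\<close> in
  \<open>jumps\<close> is attained; positive holding times make the jump times strictly increasing.
  The property passes to the path after the first jump, which permits induction over jumps.\<close>

definition regular :: "'m \<Rightarrow> 'm noise \<Rightarrow> bool" where
  "regular i \<omega> \<longleftrightarrow> (\<forall>n. 0 < hold i \<omega> n) \<and> (\<forall>B. \<exists>n. B < jump_time i \<omega> n)"

lemma regular_case_nat:
  assumes "regular i (case_nat y \<omega>)"
  shows "0 < fst (y i)" and "regular (snd (y i)) \<omega>"
proof -
  have pos: "0 < hold i (case_nat y \<omega>) n" for n
    using assms by (auto simp: regular_def)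
  from pos[of 0] show "0 < fst (y i)" by (simp add: hold_case_nat_0)
  have "\<exists>n. B < jump_time (snd (y i)) \<omega> n" for B
  proof -
    obtain n where n: "max 0 (fst (y i) + B) < jump_time i (case_nat y \<omega>) n"
      using assms unfolding regular_def by blast
    moreover from n obtain m where "n = Suc m" by (cases n) (auto simp: jump_time_def)
    ultimately show ?thesis by (intro exI[of _ m]) (auto simp: jump_time_case_nat_Suc)
  qed
  moreover have "0 < hold (snd (y i)) \<omega> n" for n
    using pos[of "Suc n"] by (simp add: hold_case_nat_Suc)
  ultimately show "regular (snd (y i)) \<omega>" by (simp add: regular_def)
qed

lemma regular_jumps:
  assumes "regular i \<omega>"
  shows "t < jump_time i \<omega> (Suc (jumps i \<omega> t))"
    and "0 \<le> t \<Longrightarrow> jump_time i \<omega> (jumps i \<omega> t) \<le> t"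
proof -
  have pos: "0 < hold i \<omega> n" for n using assms by (auto simp: regular_def)
  obtain n where "t < jump_time i \<omega> n" using assms unfolding regular_def by blast
  \<comment> \<open>\<open>jumps\<close> tests \<open>jump_time\<close> at \<open>Suc n\<close>;
    monotonicity supplies this shifted index, also when \<open>n\<close> is 0.\<close>
  then have "t < jump_time i \<omega> (Suc n)"
    using pos[of n] by (auto simp: jump_time_def)
  then show "t < jump_time i \<omega> (Suc (jumps i \<omega> t))" unfolding jumps_def by (rule LeastI)
  show "jump_time i \<omega> (jumps i \<omega> t) \<le> t" if "0 \<le> t"
  proof (cases "jumps i \<omega> t")
    case 0
    then show ?thesis using that by (simp add: jump_time_def)
  next
    case (Suc m)
    then have "m < jumps i \<omega> t" by simp
    then have "\<not> t < jump_time i \<omega> (Suc m)" unfolding jumps_def by (rule not_less_Least)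
    then show ?thesis using Suc by simp
  qed
qed

lemma jumps_case_nat:
  assumes "regular i (case_nat y \<omega>)"
  shows "t < fst (y i) \<Longrightarrow> jumps i (case_nat y \<omega>) t = 0"
    and "fst (y i) \<le> t \<Longrightarrow> jumps i (case_nat y \<omega>) t = Suc (jumps (snd (y i)) \<omega> (t - fst (y i)))"
proof -
  show "jumps i (case_nat y \<omega>) t = 0" if "t < fst (y i)"
    unfolding jumps_def jump_time_case_nat_Suc
    by (rule Least_equality) (use that in \<open>auto simp: jump_time_def\<close>)
  show "jumps i (case_nat y \<omega>) t = Suc (jumps (snd (y i)) \<omega> (t - fst (y i)))" if "fst (y i) \<le> t"
    unfolding jumps_def
  \<comment> \<open>The tested property fails at 0 because the first jump has occurred by time
    \<open>t\<close>, so the minimum can be shifted by one.\<close>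
  proof (subst Least_Suc[where n = "jumps i (case_nat y \<omega>) t"])
    show "t < jump_time i (case_nat y \<omega>) (Suc (jumps i (case_nat y \<omega>) t))"
      using regular_jumps(1)[OF assms] .
    show "\<not> t < jump_time i (case_nat y \<omega>) (Suc 0)"
      using that by (simp add: jump_time_case_nat_Suc) (simp add: jump_time_def)
    show "Suc (LEAST m. t < jump_time i (case_nat y \<omega>) (Suc (Suc m))) =
        Suc (LEAST n. t - fst (y i) < jump_time (snd (y i)) \<omega> (Suc n))"
      by (simp add: jump_time_case_nat_Suc less_diff_eq algebra_simps)
  qed
qed

lemma J_case_nat:
  assumes "regular i (case_nat y \<omega>)"
  shows "t < fst (y i) \<Longrightarrow> J_proc i (case_nat y \<omega>) t = i"
    and "fst (y i) \<le> t \<Longrightarrow> J_proc i (case_nat y \<omega>) t = J_proc (snd (y i)) \<omega> (t - fst (y i))"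
  using jumps_case_nat[OF assms]
  by (simp_all add: J_proc_def phase_case_nat_Suc del: phase.simps(2))

lemma X_case_nat:
  assumes "regular i (case_nat y \<omega>)"
  shows "t < fst (y i) \<Longrightarrow> X_proc c p x i (case_nat y \<omega>) t = x + t / c i"
    and "fst (y i) \<le> t \<Longrightarrow> X_proc c p x i (case_nat y \<omega>) t
           = X_proc c p (p i * (x + fst (y i) / c i)) (snd (y i)) \<omega> (t - fst (y i))"
proof -
  show "X_proc c p x i (case_nat y \<omega>) t = x + t / c i" if "t < fst (y i)"
    using that jumps_case_nat(1)[OF assms that] J_case_nat(1)[OF assms that]
    by (simp add: X_proc_def jump_time_def)
  show "X_proc c p x i (case_nat y \<omega>) t
           = X_proc c p (p i * (x + fst (y i) / c i)) (snd (y i)) \<omega> (t - fst (y i))" if "fst (y i) \<le> t"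
    using jumps_case_nat(2)[OF assms that] J_case_nat(2)[OF assms that]
    by (simp add: X_proc_def jump_time_case_nat_Suc jump_level_case_nat_Suc diff_diff_eq
        del: jump_level.simps(2))
qed

context drop_process
begin

section \<open>The reflected process and its passage time before and after the first jump\<close>

lemma jump_level_pos:
  assumes "0 < x" "regular i \<omega>"
  shows "0 < jump_level c p x i \<omega> n"
proof (induction n)
  case (Suc n)
  have "0 < hold i \<omega> n" using assms by (auto simp: regular_def)
  then show ?case using Suc c_pos p_pos by (auto intro!: mult_pos_pos add_pos_pos)
qed (use assms in auto)

lemma X_proc_pos:
  assumes "0 < x" "regular i \<omega>" "0 \<le> t"
  shows "0 < X_proc c p x i \<omega> t"
proof -
  have "0 \<le> (t - jump_time i \<omega> (jumps i \<omega> t)) / c (J_proc i \<omega> t)"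
    using regular_jumps(2)[OF assms(2,3)] c_pos[of "J_proc i \<omega> t"] by auto
  then show ?thesis
    using jump_level_pos[OF assms(1,2)] by (auto simp: X_proc_def intro: add_pos_nonneg)
qed

lemma X_proc_0:
  assumes "regular i \<omega>"
  shows "X_proc c p x i \<omega> 0 = x"
proof -
  have "jumps i \<omega> 0 = 0"
    unfolding jumps_def
    by (rule Least_equality) (use assms in \<open>auto simp: jump_time_def regular_def\<close>)
  then show ?thesis by (simp add: X_proc_def jump_time_def)
qed

text \<open>The infimum in \<open>X_min\<close> is taken in the reals and is meaningful only for
  sets bounded below; positivity of the level provides the bound 0.\<close>

lemma bdd_below_X:
  assumes "0 < x" "regular i \<omega>" "S \<subseteq> {0..}"
  shows "bdd_below (X_proc c p x i \<omega> ` S)"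
  using X_proc_pos[OF assms(1,2)] assms(3) by (intro bdd_belowI2[of _ 0]) (auto intro: less_imp_le)

lemma Y_before_jump:
  assumes "regular i (case_nat y \<omega>)" "0 < v" "v \<le> x" "0 \<le> t" "t < fst (y i)"
  shows "Y_proc c p x v i (case_nat y \<omega>) t = x + t / c i - v"
proof -
  let ?\<eta> = "case_nat y \<omega>"
  have X: "X_proc c p x i ?\<eta> s = x + s / c i" if "s \<le> t" for s
    using X_case_nat(1)[OF assms(1)] that assms(5) by simp
  have "v \<le> (INF s\<in>{0..t}. X_proc c p x i ?\<eta> s)"
  proof (rule cINF_greatest)
    fix s assume "s \<in> {0..t}"
    then show "v \<le> X_proc c p x i ?\<eta> s"
      using X[of s] c_pos[of i] assms(3) by (auto intro: add_increasing2)
  qed (use assms in auto)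
  then show ?thesis using X[of t] by (simp add: Y_proc_def X_min_def min_def)
qed

text \<open>Before the jump the level increases from \<open>x \<ge> v\<close>, so that stretch does
  not lower the minimum. Restarting with \<open>min v x'\<close> instead of \<open>v\<close> changes
  nothing either, because \<open>x'\<close> is the value at time 0 of the restarted path and already
  enters its infimum.\<close>

lemma Y_after_jump:
  assumes reg: "regular i (case_nat y \<omega>)" and v: "0 < v" "v \<le> x" and t: "fst (y i) \<le> t"
  defines "x' \<equiv> p i * (x + fst (y i) / c i)"
  shows "Y_proc c p x v i (case_nat y \<omega>) t
       = Y_proc c p x' (min v x') (snd (y i)) \<omega> (t - fst (y i))"
proof -
  let ?\<eta> = "case_nat y \<omega>" and ?h = "fst (y i)" and ?k = "snd (y i)"
  note h = regular_case_nat[OF reg]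
  have x': "0 < x'" using v h(1) c_pos[of i] p_pos[of i]
    unfolding x'_def by (intro mult_pos_pos add_pos_pos divide_pos_pos) auto
  define I where "I = (INF s\<in>{0..t - ?h}. X_proc c p x' ?k \<omega> s)"
  have "{0..t} = {0..<?h} \<union> (\<lambda>s. ?h + s) ` {0..t - ?h}"
  proof (intro set_eqI iffI)
    fix s assume "s \<in> {0..t}"
    then show "s \<in> {0..<?h} \<union> (\<lambda>s. ?h + s) ` {0..t - ?h}"
      by (cases "s < ?h") (auto intro!: image_eqI[of _ _ "s - ?h"])
  qed (use t h(1) in auto)
  then have "(INF s\<in>{0..t}. X_proc c p x i ?\<eta> s)
      = min (INF s\<in>{0..<?h}. X_proc c p x i ?\<eta> s) (INF s\<in>(\<lambda>s. ?h + s) ` {0..t - ?h}. X_proc c p x i ?\<eta> s)"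
    using h(1) t v reg by (simp only: inf_min[symmetric]) (intro cINF_union bdd_below_X, auto)
  also have "(INF s\<in>(\<lambda>s. ?h + s) ` {0..t - ?h}. X_proc c p x i ?\<eta> s) = I"
    unfolding image_image I_def
    by (intro arg_cong[where f = Inf] image_cong) (auto simp: X_case_nat(2)[OF reg] x'_def)
  also have "(INF s\<in>{0..<?h}. X_proc c p x i ?\<eta> s) = x"
  proof (rule cInf_eq_minimum)
    show "x \<in> X_proc c p x i ?\<eta> ` {0..<?h}"
      using h(1) X_case_nat(1)[OF reg, of 0] by (intro image_eqI[of _ _ 0]) auto
    fix z assume "z \<in> X_proc c p x i ?\<eta> ` {0..<?h}"
    then show "x \<le> z" using c_pos[of i] by (auto simp: X_case_nat(1)[OF reg])
  qed
  finally have 1: "X_min c p x v i ?\<eta> t = min v I" using v by (simp add: X_min_def)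
  have "I \<le> X_proc c p x' ?k \<omega> 0"
    unfolding I_def using t h x' by (intro cINF_lower bdd_below_X) auto
  then have "I \<le> x'" using X_proc_0[OF h(2)] by simp
  then have "X_min c p x' (min v x') ?k \<omega> (t - ?h) = min v I"
    by (simp add: X_min_def I_def[symmetric])
  then show ?thesis using 1 X_case_nat(2)[OF reg t] by (simp add: Y_proc_def x'_def)
qed

text \<open>\<open>c i * (v + a - x)\<close> is the time needed to climb from \<open>x\<close> to
  \<open>v + a\<close> at slope \<open>1 / c i\<close>. The inequality is strict because paths are
  right-continuous: a jump exactly at this time is already performed when \<open>Y\<close> is
  evaluated, so that case belongs to \<open>tau_jump\<close>.\<close>

lemma tau_no_jump:
  assumes reg: "regular i (case_nat y \<omega>)" and v: "0 < v" "v \<le> x" "x < v + a"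
    and h: "c i * (v + a - x) < fst (y i)"
  shows "tau c p a x v i (case_nat y \<omega>) = ereal (c i * (v + a - x))"
proof -
  let ?d = "c i * (v + a - x)"
  have d: "0 \<le> ?d" using c_pos[of i] v by auto
  note Y = Y_before_jump[OF reg v(1,2)]
  show ?thesis unfolding tau_def
  proof (rule antisym)
    have "a \<le> Y_proc c p x v i (case_nat y \<omega>) ?d"
      using Y[OF d h] c_pos[of i] by simp
    then show "(INF t\<in>{t. 0 \<le> t \<and> a \<le> Y_proc c p x v i (case_nat y \<omega>) t}. ereal t) \<le> ereal ?d"
      using d by (intro INF_lower) auto
    show "ereal ?d \<le> (INF t\<in>{t. 0 \<le> t \<and> a \<le> Y_proc c p x v i (case_nat y \<omega>) t}. ereal t)"
    proof (rule INF_greatest)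
      fix t assume t: "t \<in> {t. 0 \<le> t \<and> a \<le> Y_proc c p x v i (case_nat y \<omega>) t}"
      show "ereal ?d \<le> ereal t"
      proof (rule ccontr)
        assume "\<not> ereal ?d \<le> ereal t"
        then have "t < ?d" by simp
        then have "a \<le> x + t / c i - v" using t Y[of t] h by auto
        then have "?d \<le> t" using c_pos[of i] by (simp add: field_simps)
        with \<open>t < ?d\<close> show False by simp
      qed
    qed
  qed
qed

lemma tau_jump:
  assumes reg: "regular i (case_nat y \<omega>)" and v: "0 < v" "v \<le> x" "x < v + a"
    and h: "fst (y i) \<le> c i * (v + a - x)"
  defines "x' \<equiv> p i * (x + fst (y i) / c i)"
  shows "tau c p a x v i (case_nat y \<omega>)
    = ereal (fst (y i)) + tau c p a x' (min v x') (snd (y i)) \<omega>"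
proof -
  let ?h = "fst (y i)"
  let ?S = "{t. 0 \<le> t \<and> a \<le> Y_proc c p x v i (case_nat y \<omega>) t}"
  let ?S' = "{t. 0 \<le> t \<and> a \<le> Y_proc c p x' (min v x') (snd (y i)) \<omega> t}"
  have h0: "0 < ?h" using regular_case_nat[OF reg] by simp
  have le: "?h \<le> t" if "t \<in> ?S" for t
  proof (rule ccontr)
    assume "\<not> ?h \<le> t"
    then have t: "t < ?h" by simp
    then have "a \<le> x + t / c i - v" using Y_before_jump[OF reg v(1,2), of t] that by auto
    then have "c i * (v + a - x) \<le> t" using c_pos[of i] by (simp add: field_simps)
    then show False using t h by simp
  qed
  have S: "?S = (\<lambda>t. ?h + t) ` ?S'"
  proof (intro set_eqI iffI)
    fix t assume t: "t \<in> ?S"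
    then have "t - ?h \<in> ?S'"
      using le[OF t] Y_after_jump[OF reg v(1,2) le[OF t]] by (simp add: x'_def)
    then show "t \<in> (\<lambda>t. ?h + t) ` ?S'" by (intro image_eqI[of _ _ "t - ?h"]) auto
  next
    fix t assume "t \<in> (\<lambda>t. ?h + t) ` ?S'"
    then obtain s where s: "t = ?h + s" "s \<in> ?S'" by blast
    then show "t \<in> ?S"
      using h0 Y_after_jump[OF reg v(1,2), of t] by (auto simp: x'_def)
  qed
  show ?thesis
  \<comment> \<open>With no passage at all both infima are infinite; pulling the constant out of the
    infimum requires a nonempty index set.\<close>
  proof (cases "?S' = {}")
    case True
    then show ?thesis unfolding tau_def S True by (simp add: top_ereal_def)
  next
    case False
    have "(INF t\<in>?S'. ereal ?h + ereal t) = ereal ?h + (INF t\<in>?S'. ereal t)"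
      using False by (intro INF_ereal_add_right) (auto intro!: INF_greatest)
    then show ?thesis unfolding tau_def S by (simp add: image_image)
  qed
qed

definition passage_functional :: "real \<Rightarrow> real \<Rightarrow> 'm \<Rightarrow> 'm \<Rightarrow> 'm noise \<Rightarrow> ennreal" where
  "passage_functional x v i j \<omega> = ennreal (exp (- w * real_of_ereal (tau c p a x v i \<omega>)))
     * indicator {\<omega>. tau c p a x v i \<omega> < \<infinity> \<and> J_proc i \<omega> (real_of_ereal (tau c p a x v i \<omega>)) = j} \<omega>"

lemma tau_nonneg: "0 \<le> tau c p a x v i \<omega>"
  unfolding tau_def by (intro INF_greatest) auto

lemma passage_functional_le_1: "passage_functional x v i j \<omega> \<le> 1"
proof -
  have "0 \<le> real_of_ereal (tau c p a x v i \<omega>)" by (intro real_of_ereal_pos tau_nonneg)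
  then have "ennreal (exp (- w * real_of_ereal (tau c p a x v i \<omega>))) \<le> 1"
    using w_pos by (simp add: ennreal_le_1)
  then show ?thesis by (auto simp: passage_functional_def indicator_def)
qed

text \<open>The first-step recursion behind the integral equation. The discount is multiplicative
  along \<open>tau = h + tau'\<close>, and the phase at passage is that of the shifted path. If
  \<open>tau'\<close> is infinite, the indicators make both sides 0.\<close>

lemma passage_functional_case_nat:
  assumes reg: "regular i (case_nat y \<omega>)" and v: "0 < v" "v \<le> x" "x < v + a"
  defines "x' \<equiv> p i * (x + fst (y i) / c i)"
  shows "passage_functional x v i j (case_nat y \<omega>) =
     (if c i * (v + a - x) < fst (y i) then ennreal (exp (- w * (c i * (v + a - x)))) * of_bool (i = j)
      else ennreal (exp (- w * fst (y i))) * passage_functional x' (min v x') (snd (y i)) j \<omega>)"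
proof (cases "c i * (v + a - x) < fst (y i)")
  case True
  then show ?thesis
    using tau_no_jump[OF reg v True] J_case_nat(1)[OF reg True]
    by (simp add: passage_functional_def indicator_def)
next
  case False
  let ?h = "fst (y i)" and ?\<tau> = "tau c p a x' (min v x') (snd (y i)) \<omega>"
  have tau: "tau c p a x v i (case_nat y \<omega>) = ereal ?h + ?\<tau>"
    using tau_jump[OF reg v] False by (simp add: x'_def)
  show ?thesis
  proof (cases "?\<tau> = \<infinity>")
    case True
    then show ?thesis using False by (simp add: passage_functional_def tau)
  next
    case fin: False
    then obtain t where t: "?\<tau> = ereal t" "0 \<le> t"
      using tau_nonneg[of x' "min v x'" "snd (y i)" \<omega>] by (cases ?\<tau>) auto
    have J: "J_proc i (case_nat y \<omega>) (?h + t) = J_proc (snd (y i)) \<omega> t"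
      using J_case_nat(2)[OF reg, of "?h + t"] t by simp
    have "exp (- w * (?h + t)) = exp (- w * ?h) * exp (- w * t)"
      by (simp add: exp_add[symmetric] algebra_simps)
    then show ?thesis using False
      by (simp add: passage_functional_def tau t(1) J indicator_def ennreal_mult)
  qed
qed

end

section \<open>The law of the first jump\<close>

context drop_process
begin

abbreviation noise_law :: "'m noise measure" where
  "noise_law \<equiv> noise lam Q"

definition jump_law :: "'m \<Rightarrow> (real \<times> 'm) measure" where
  "jump_law i = density lborel (exponential_density (lam i))
     \<Otimes>\<^sub>M point_measure UNIV (\<lambda>j. ennreal (Q $ i $ j))"

definition step_law :: "('m \<Rightarrow> real \<times> 'm) measure" where
  "step_law = (\<Pi>\<^sub>M i\<in>UNIV. jump_law i)"

lemma noise_law_eq: "noise_law = (\<Pi>\<^sub>M n\<in>UNIV. step_law)"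
  unfolding noise_def step_law_def jump_law_def ..

lemma prob_space_next_phase: "prob_space (point_measure UNIV (\<lambda>j. ennreal (Q $ i $ j)))"
proof (rule prob_space_point_measure)
  show "(\<Sum>j\<in>UNIV. ennreal (Q $ i $ j)) = 1"
    using Q_nonneg Q_sum by (simp add: sum_ennreal)
qed auto

lemma prob_space_jump_law: "prob_space (jump_law i)"
  unfolding jump_law_def
  by (intro prob_space_pair prob_space_exponential_density lam_pos prob_space_next_phase)

lemma prob_space_step_law: "prob_space step_law"
  unfolding step_law_def by (intro prob_space_PiM prob_space_jump_law)

lemma prob_space_noise_law: "prob_space noise_law"
  unfolding noise_law_eq by (intro prob_space_PiM prob_space_step_law)

lemma sets_jump_law [measurable_cong]: "sets (jump_law i) = sets (borel \<Otimes>\<^sub>M count_space UNIV)"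
  unfolding jump_law_def by (intro sets_pair_measure_cong) (auto simp: sets_point_measure)

lemma space_noise_law [simp]: "space noise_law = UNIV"
  by (auto simp: noise_law_eq step_law_def space_PiM jump_law_def space_pair_measure
      space_point_measure PiE_def extensional_def)

lemma measurable_jump: "(\<lambda>\<omega>. \<omega> n i) \<in> noise_law \<rightarrow>\<^sub>M borel \<Otimes>\<^sub>M count_space UNIV"
proof -
  have "(\<lambda>\<omega>. \<omega> n) \<in> noise_law \<rightarrow>\<^sub>M step_law"
    unfolding noise_law_eq by (rule measurable_component_singleton) simp
  moreover have "(\<lambda>y. y i) \<in> step_law \<rightarrow>\<^sub>M jump_law i"
    unfolding step_law_def by (rule measurable_component_singleton) simp
  ultimately have "(\<lambda>\<omega>. \<omega> n i) \<in> noise_law \<rightarrow>\<^sub>M jump_law i"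
    by (rule measurable_compose)
  then show ?thesis by (simp cong: measurable_cong_sets add: sets_jump_law)
qed

lemma measurable_shift: "(\<lambda>\<omega> n. \<omega> (Suc n)) \<in> noise_law \<rightarrow>\<^sub>M noise_law"
  unfolding noise_law_eq
  by (rule measurable_PiM_single') (auto simp: space_PiM PiE_iff intro!: measurable_component_singleton)

text \<open>An infinite product of copies of one law is unchanged when an independent copy is put in
  front: by \<open>PiM_iter\<close> it is the image of
  \<open>step_law \<Otimes>\<^sub>M noise_law\<close> under \<open>case_nat\<close>.\<close>

lemma nn_integral_noise_iter:
  assumes [measurable]: "f \<in> borel_measurable noise_law"
  shows "(\<integral>\<^sup>+\<omega>. f \<omega> \<partial>noise_law) = (\<integral>\<^sup>+\<omega>. \<integral>\<^sup>+y. f (case_nat y \<omega>) \<partial>step_law \<partial>noise_law)"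
proof -
  interpret S: prob_space step_law by (rule prob_space_step_law)
  interpret P: product_prob_space "\<lambda>_. step_law" "UNIV :: nat set" ..
  interpret sequence_space step_law ..
  interpret N: prob_space noise_law by (rule prob_space_noise_law)
  interpret pair_sigma_finite step_law noise_law ..
  have iter: "distr (step_law \<Otimes>\<^sub>M noise_law) noise_law (\<lambda>(s, \<omega>). case_nat s \<omega>) = noise_law"
    using PiM_iter unfolding noise_law_eq .
  have [measurable]: "(\<lambda>(s, \<omega>). case_nat s \<omega>) \<in> step_law \<Otimes>\<^sub>M noise_law \<rightarrow>\<^sub>M noise_law"
    unfolding noise_law_eq by measurable
  have "(\<integral>\<^sup>+\<omega>. f \<omega> \<partial>noise_law) = (\<integral>\<^sup>+z. f ((\<lambda>(s, \<omega>). case_nat s \<omega>) z) \<partial>(step_law \<Otimes>\<^sub>M noise_law))"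
    by (subst iter[symmetric]) (rule nn_integral_distr, measurable)
  also have "\<dots> = (\<integral>\<^sup>+\<omega>. \<integral>\<^sup>+y. f (case_nat y \<omega>) \<partial>step_law \<partial>noise_law)"
    by (subst nn_integral_snd[symmetric]) (simp_all add: case_prod_unfold)
  finally show ?thesis .
qed

lemma nn_integral_jump:
  assumes [measurable]: "g \<in> borel_measurable (borel \<Otimes>\<^sub>M count_space UNIV)"
  shows "(\<integral>\<^sup>+y. g (y i) \<partial>step_law) =
     (\<integral>\<^sup>+h. ennreal (exponential_density (lam i) h) * (\<Sum>k\<in>UNIV. ennreal (Q $ i $ k) * g (h, k)) \<partial>lborel)"
proof -
  interpret E: prob_space "density lborel (exponential_density (lam i))"
    using lam_pos by (rule prob_space_exponential_density)
  interpret P: prob_space "point_measure UNIV (\<lambda>j. ennreal (Q $ i $ j))"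
    by (rule prob_space_next_phase)
  have [measurable]: "g \<in> borel_measurable (jump_law i)"
    using assms by (simp cong: measurable_cong_sets add: sets_jump_law)
  have [measurable]: "(\<lambda>h. g (h, k)) \<in> borel_measurable borel" for k
    by measurable
  have meas: "(\<lambda>y. y i) \<in> step_law \<rightarrow>\<^sub>M jump_law i"
    unfolding step_law_def by (rule measurable_component_singleton) simp
  have "(\<integral>\<^sup>+y. g (y i) \<partial>step_law) = (\<integral>\<^sup>+z. g z \<partial>distr step_law (jump_law i) (\<lambda>y. y i))"
  proof (rule nn_integral_distr[OF meas, symmetric])
    show "g \<in> borel_measurable (distr step_law (jump_law i) (\<lambda>y. y i))"
      unfolding measurable_distr_eq1 by fact
  qed
  also have "\<dots> = (\<integral>\<^sup>+z. g z \<partial>jump_law i)"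
  proof -
    have "distr step_law (jump_law i) (\<lambda>y. y i) = jump_law i"
      unfolding step_law_def by (rule distr_PiM_component[OF prob_space_jump_law UNIV_I])
    then show ?thesis by (rule arg_cong)
  qed
  also have "\<dots> = (\<integral>\<^sup>+h. (\<integral>\<^sup>+k. g (h, k) \<partial>point_measure UNIV (\<lambda>j. ennreal (Q $ i $ j)))
      \<partial>density lborel (exponential_density (lam i)))"
    using \<open>g \<in> borel_measurable (jump_law i)\<close> unfolding jump_law_def
    by (rule P.nn_integral_fst[symmetric])
  also have "\<dots> = (\<integral>\<^sup>+h. (\<Sum>k\<in>UNIV. ennreal (Q $ i $ k) * g (h, k)) \<partial>density lborel (exponential_density (lam i)))"
    by (simp add: nn_integral_point_measure_finite)
  also have "\<dots> = (\<integral>\<^sup>+h. ennreal (exponential_density (lam i) h) * (\<Sum>k\<in>UNIV. ennreal (Q $ i $ k) * g (h, k)) \<partial>lborel)"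
    by (subst nn_integral_density) auto
  finally show ?thesis .
qed

text \<open>The Markov property at the first jump in integral form: holding time, next phase and
  shifted noise are independent, so the joint expectation becomes an iterated one.\<close>

lemma nn_integral_first_jump:
  assumes f [measurable]: "\<And>k. (\<lambda>(h, \<omega>). f k h \<omega>) \<in> borel_measurable (borel \<Otimes>\<^sub>M noise_law)"
  shows "(\<integral>\<^sup>+\<omega>. f (snd (\<omega> 0 i)) (fst (\<omega> 0 i)) (\<lambda>n. \<omega> (Suc n)) \<partial>noise_law) =
     (\<integral>\<^sup>+h. ennreal (exponential_density (lam i) h) * (\<Sum>k\<in>UNIV. ennreal (Q $ i $ k) * (\<integral>\<^sup>+\<omega>. f k h \<omega> \<partial>noise_law)) \<partial>lborel)"
proof -
  interpret N: prob_space noise_law by (rule prob_space_noise_law)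
  interpret pair_sigma_finite lborel noise_law ..
  note [measurable] = measurable_jump measurable_shift
  have [measurable]: "(\<lambda>z. f k (g z) (s z)) \<in> borel_measurable N"
    if "g \<in> borel_measurable N" "s \<in> N \<rightarrow>\<^sub>M noise_law" for k g s and N :: "'z measure"
    using measurable_compose[OF measurable_Pair[OF that] f] by simp
  \<comment> \<open>The first argument of \<open>f\<close> is a random phase. There are only
    finitely many phases, so measurability for each fixed phase suffices.\<close>
  have meas: "(\<lambda>\<omega>. f (snd (\<omega> 0 i)) (fst (\<omega> 0 i)) (\<lambda>n. \<omega> (Suc n))) \<in> borel_measurable noise_law"
    by (rule measurable_compose_countable) measurable
  have jump: "(\<lambda>z. f (snd z) (fst z) \<omega>) \<in> borel_measurable (borel \<Otimes>\<^sub>M count_space UNIV)" for \<omega>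
    by (rule measurable_compose_countable) measurable
  have "(\<integral>\<^sup>+\<omega>. f (snd (\<omega> 0 i)) (fst (\<omega> 0 i)) (\<lambda>n. \<omega> (Suc n)) \<partial>noise_law)
      = (\<integral>\<^sup>+\<omega>. \<integral>\<^sup>+y. f (snd (y i)) (fst (y i)) \<omega> \<partial>step_law \<partial>noise_law)"
    by (subst nn_integral_noise_iter[OF meas]) simp
  also have "\<dots> = (\<integral>\<^sup>+\<omega>. \<integral>\<^sup>+h. ennreal (exponential_density (lam i) h) * (\<Sum>k\<in>UNIV. ennreal (Q $ i $ k) * f k h \<omega>) \<partial>lborel \<partial>noise_law)"
    using nn_integral_jump[OF jump] by simp
  also have "\<dots> = (\<integral>\<^sup>+h. \<integral>\<^sup>+\<omega>. ennreal (exponential_density (lam i) h) * (\<Sum>k\<in>UNIV. ennreal (Q $ i $ k) * f k h \<omega>) \<partial>noise_law \<partial>lborel)"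
    by (rule Fubini') measurable
  also have "\<dots> = (\<integral>\<^sup>+h. ennreal (exponential_density (lam i) h) * (\<Sum>k\<in>UNIV. ennreal (Q $ i $ k) * (\<integral>\<^sup>+\<omega>. f k h \<omega> \<partial>noise_law)) \<partial>lborel)"
    by (simp add: nn_integral_cmult nn_integral_sum)
  finally show ?thesis .
qed

text \<open>The part of the passage functional that comes from paths with fewer than \<open>n\<close> jumps before the
  passage.\<close>

primrec passage_upto :: "nat \<Rightarrow> real \<Rightarrow> real \<Rightarrow> 'm \<Rightarrow> 'm \<Rightarrow> 'm noise \<Rightarrow> ennreal" where
  "passage_upto 0 x v i j \<omega> = 0"
| "passage_upto (Suc n) x v i j \<omega> =
     (if c i * (v + a - x) < fst (\<omega> 0 i)
      then ennreal (exp (- w * (c i * (v + a - x)))) * of_bool (i = j)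
      else ennreal (exp (- w * fst (\<omega> 0 i)))
        * passage_upto n (p i * (x + fst (\<omega> 0 i) / c i)) (min v (p i * (x + fst (\<omega> 0 i) / c i)))
            (snd (\<omega> 0 i)) j (\<lambda>n. \<omega> (Suc n)))"

lemma measurable_jump_compose:
  assumes "s \<in> M \<rightarrow>\<^sub>M noise_law"
  shows "(\<lambda>z. fst (s z n i)) \<in> borel_measurable M" and "(\<lambda>z. snd (s z n i)) \<in> M \<rightarrow>\<^sub>M count_space UNIV"
proof -
  have "(\<lambda>z. s z n i) \<in> M \<rightarrow>\<^sub>M borel \<Otimes>\<^sub>M count_space UNIV"
    using measurable_compose[OF assms measurable_jump] .
  then show "(\<lambda>z. fst (s z n i)) \<in> borel_measurable M" "(\<lambda>z. snd (s z n i)) \<in> M \<rightarrow>\<^sub>M count_space UNIV"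
    using measurable_compose[OF _ measurable_fst] measurable_compose[OF _ measurable_snd] by blast+
qed

lemma measurable_passage_upto:
  assumes "f \<in> borel_measurable M" "g \<in> borel_measurable M" "s \<in> M \<rightarrow>\<^sub>M noise_law"
  shows "(\<lambda>z. passage_upto n (f z) (g z) i j (s z)) \<in> borel_measurable M"
  using assms
proof (induction n arbitrary: f g s i)
  case (Suc n)
  have f [measurable]: "f \<in> borel_measurable M" and g [measurable]: "g \<in> borel_measurable M" by fact+
  have h [measurable]: "(\<lambda>z. fst (s z 0 i)) \<in> borel_measurable M"
    and k: "(\<lambda>z. snd (s z 0 i)) \<in> M \<rightarrow>\<^sub>M count_space UNIV"
    by (intro measurable_jump_compose Suc.prems)+
  have s: "(\<lambda>z n. s z (Suc n)) \<in> M \<rightarrow>\<^sub>M noise_law"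
    by (rule measurable_compose[OF Suc.prems(3) measurable_shift])
  let ?x' = "\<lambda>z. p i * (f z + fst (s z 0 i) / c i)"
  have x': "?x' \<in> borel_measurable M" "(\<lambda>z. min (g z) (?x' z)) \<in> borel_measurable M"
    by measurable
  have [measurable]: "(\<lambda>z. passage_upto n (?x' z) (min (g z) (?x' z)) (snd (s z 0 i)) j (\<lambda>n. s z (Suc n))) \<in> borel_measurable M"
    by (rule measurable_compose_countable[OF Suc.IH[OF x' s] k])
  show ?case unfolding passage_upto.simps by measurable
qed simp

lemma passage_upto_Suc_ge: "passage_upto n x v i j \<omega> \<le> passage_upto (Suc n) x v i j \<omega>"
proof (induction n arbitrary: x v i \<omega>)
  case (Suc n)
  show ?case
    unfolding passage_upto.simps(2)[of "Suc n" x v i j \<omega>] passage_upto.simps(2)[of n x v i j \<omega>]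
    by (cases "c i * (v + a - x) < fst (\<omega> 0 i)")
       (simp_all only: if_True if_False order_refl mult_left_mono[OF Suc.IH] zero_le simp_thms)
qed simp

lemma case_nat_shift: "case_nat (\<omega> 0) (\<lambda>n. \<omega> (Suc n)) = \<omega>"
  by (auto simp: fun_eq_iff split: nat.split)

text \<open>Invariance of the domain under a jump before passage: contraction by
  \<open>p i < 1\<close> takes a level of at most \<open>v + a\<close> strictly below
  \<open>v + a\<close>, and when the jump goes below \<open>v\<close> the new reflected height is 0,
  less than \<open>a\<close>.\<close>

lemma jump_domain:
  assumes v: "0 < v" "v \<le> x" "x < v + a" and h: "0 \<le> h" "h \<le> c i * (v + a - x)"
  defines "x' \<equiv> p i * (x + h / c i)"
  shows "0 < min v x'" "min v x' \<le> x'" "x' < min v x' + a"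
proof -
  have y: "0 < x + h / c i" "x + h / c i \<le> v + a"
    using v h c_pos[of i] by (auto intro!: add_pos_nonneg) (auto simp: field_simps)
  have "x' < v + a" using p_mult_less[OF y(1), of i] y(2) by (simp add: x'_def)
  moreover have "0 < x'" using p_pos[of i] y(1) by (simp add: x'_def)
  ultimately show "0 < min v x'" "min v x' \<le> x'" "x' < min v x' + a"
    using v a_pos by (auto simp: min_def)
qed

text \<open>What truncation discards is passage after \<open>n\<close> jumps, which is discounted by
  at least \<open>exp (- w * T)\<close> for the \<open>n\<close>-th jump time \<open>T\<close>. In
  the induction each jump contributes one factor \<open>exp (- w * h)\<close>; the base case is the
  bound by 1.\<close>

lemma passage_upto_bounds:
  assumes "regular i \<omega>" "0 < v" "v \<le> x" "x < v + a"
  shows "passage_upto n x v i j \<omega> \<le> passage_functional x v i j \<omega>"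
    and "passage_functional x v i j \<omega> \<le> passage_upto n x v i j \<omega> + ennreal (exp (- w * jump_time i \<omega> n))"
proof -
  have "passage_upto n x v i j \<omega> \<le> passage_functional x v i j \<omega> \<and>
    passage_functional x v i j \<omega> \<le> passage_upto n x v i j \<omega> + ennreal (exp (- w * jump_time i \<omega> n))"
    using assms
  proof (induction n arbitrary: x v i \<omega>)
    case 0
    then show ?case using passage_functional_le_1 by (simp add: jump_time_def)
  next
    case (Suc n)
    let ?h = "fst (\<omega> 0 i)" and ?k = "snd (\<omega> 0 i)" and ?s = "\<lambda>n. \<omega> (Suc n)"
    let ?x' = "p i * (x + ?h / c i)"
    let ?e = "ennreal (exp (- w * ?h))"
    have reg: "regular i (case_nat (\<omega> 0) ?s)" using Suc.prems(1) by (simp add: case_nat_shift)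
    note pf = passage_functional_case_nat[OF reg Suc.prems(2-4), of j, unfolded case_nat_shift]
    show ?case
    proof (cases "c i * (v + a - x) < ?h")
      case True
      then show ?thesis by (simp add: pf)
    next
      case False
      have h: "0 < ?h" "regular ?k ?s" using regular_case_nat[OF reg] by auto
      note dom = jump_domain[OF Suc.prems(2-4) less_imp_le[OF h(1)], of i]
      have IH: "passage_upto n ?x' (min v ?x') ?k j ?s \<le> passage_functional ?x' (min v ?x') ?k j ?s"
        "passage_functional ?x' (min v ?x') ?k j ?s \<le> passage_upto n ?x' (min v ?x') ?k j ?s + ennreal (exp (- w * jump_time ?k ?s n))"
        using Suc.IH[OF h(2) dom] False by auto
      have "exp (- w * jump_time i \<omega> (Suc n)) = exp (- w * ?h) * exp (- w * jump_time ?k ?s n)"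
        using jump_time_case_nat_Suc[of i "\<omega> 0" ?s n]
        by (simp add: case_nat_shift exp_add[symmetric] algebra_simps)
      then have T: "ennreal (exp (- w * jump_time i \<omega> (Suc n))) = ?e * ennreal (exp (- w * jump_time ?k ?s n))"
        by (simp add: ennreal_mult)
      show ?thesis
        using mult_left_mono[OF IH(1), of ?e] mult_left_mono[OF IH(2), of ?e] False
        unfolding pf T by (simp add: distrib_left)
    qed
  qed
  then show "passage_upto n x v i j \<omega> \<le> passage_functional x v i j \<omega>"
    "passage_functional x v i j \<omega> \<le> passage_upto n x v i j \<omega> + ennreal (exp (- w * jump_time i \<omega> n))" by auto
qed

lemma passage_functional_eq_SUP:
  assumes "regular i \<omega>" "0 < v" "v \<le> x" "x < v + a"
  shows "passage_functional x v i j \<omega> = (SUP n. passage_upto n x v i j \<omega>)"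
proof (rule antisym)
  show "(SUP n. passage_upto n x v i j \<omega>) \<le> passage_functional x v i j \<omega>"
    by (intro SUP_least passage_upto_bounds assms)
  show "passage_functional x v i j \<omega> \<le> (SUP n. passage_upto n x v i j \<omega>)"
  proof (rule ennreal_le_epsilon)
    fix e :: real assume e: "0 < e"
    \<comment> \<open>Solving \<open>exp (- w * T) \<le> e\<close> for \<open>T\<close> gives this
      threshold, exceeded by some jump time since the path does not explode.\<close>
    obtain n where n: "- ln e / w < jump_time i \<omega> n" using assms(1) unfolding regular_def by blast
    then have "- w * jump_time i \<omega> n \<le> ln e" using w_pos by (simp add: field_simps)
    then have "exp (- w * jump_time i \<omega> n) \<le> e" using e by (metis exp_le_cancel_iff exp_ln)
    then have "passage_functional x v i j \<omega> \<le> passage_upto n x v i j \<omega> + ennreal e"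
      using passage_upto_bounds(2)[OF assms, of j n] by (meson add_left_mono ennreal_leI order_trans)
    also have "\<dots> \<le> (SUP n. passage_upto n x v i j \<omega>) + ennreal e"
      by (intro add_right_mono SUP_upper) simp
    finally show "passage_functional x v i j \<omega> \<le> (SUP n. passage_upto n x v i j \<omega>) + ennreal e" .
  qed
qed

end

section \<open>The first-jump operator\<close>

text \<open>Moves a variable endpoint of integration into the integrand. Over the fixed interval
  \<open>{0..1}\<close>, continuity in the parameters follows from joint continuity of the
  integrand.\<close>

lemma integral_unit_interval:
  fixes f :: "real \<Rightarrow> real"
  assumes "x \<le> u" "continuous_on {x..u} f"
  shows "integral {x..u} f = (u - x) * integral {0..1} (\<lambda>r. f (x + r * (u - x)))"
proof (cases "x = u")
  case False
  then have m: "0 < u - x" using assms by simp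
  have "(f has_integral integral {x..u} f) (cbox x u)"
    using assms integrable_continuous_real by (simp add: cbox_interval has_integral_integral)
  from has_integral_affinity'[OF this m, of x]
  have "((\<lambda>r. f (x + r * (u - x))) has_integral (integral {x..u} f / (u - x))) {0..1}"
    using m by (simp add: cbox_interval mult.commute add.commute divide_inverse)
  then show ?thesis using m by (simp add: integral_unique)
qed simp

context drop_process
begin

text \<open>The edge \<open>x = v + a\<close> is included because the boundary condition is read
  there and the integrals in \<open>first_jump\<close> extend to it.\<close>

definition strip :: "(real \<times> real) set" where
  "strip = {(x, v). 0 < v \<and> v \<le> x \<and> x \<le> v + a}"

text \<open>Climbing one unit of level takes time \<open>c i\<close>, so this is the combined rate
  of killing and jumping per unit of level.\<close>

definition decay :: "'m \<Rightarrow> real" where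
  "decay i = c i * (w + lam i)"

text \<open>The \<open>min\<close> merges the two cases of the boundary value problem: for
  \<open>p i * y < v\<close> both arguments of \<open>U\<close> agree, the \<open>H_a\<close> case,
  and otherwise the second argument is \<open>v\<close>, the \<open>F\<close> case.\<close>

definition jump_average :: "(real \<Rightarrow> real \<Rightarrow> 'm \<Rightarrow> 'm \<Rightarrow> real) \<Rightarrow> real \<Rightarrow> real \<Rightarrow> 'm \<Rightarrow> 'm \<Rightarrow> real" where
  "jump_average U y v i j = (\<Sum>k\<in>UNIV. Q $ i $ k * U (p i * y) (min v (p i * y)) k j)"

text \<open>The variable of integration \<open>y = x + h / c i\<close> is the level just before a first jump at time \<open>h\<close>.\<close>

definition first_jump :: "(real \<Rightarrow> real \<Rightarrow> 'm \<Rightarrow> 'm \<Rightarrow> real) \<Rightarrow> real \<Rightarrow> real \<Rightarrow> 'm \<Rightarrow> 'm \<Rightarrow> real" where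
  "first_jump U x v i j = exp (- decay i * (v + a - x)) * of_bool (i = j)
     + integral {x..v + a} (\<lambda>y. lam i * c i * exp (- decay i * (y - x)) * jump_average U y v i j)"

definition continuous_kernel :: "(real \<Rightarrow> real \<Rightarrow> 'm \<Rightarrow> 'm \<Rightarrow> real) \<Rightarrow> bool" where
  "continuous_kernel U \<longleftrightarrow> (\<forall>i j. continuous_on strip (\<lambda>z. U (fst z) (snd z) i j))"

lemma decay_pos: "0 < decay i"
  using c_pos lam_pos w_pos by (simp add: decay_def add_pos_pos)

lemma after_jump_strip:
  assumes "(y, v) \<in> strip"
  shows "(p i * y, min v (p i * y)) \<in> strip"
proof -
  have y: "0 < y" "y \<le> v + a" "0 < v" using assms by (auto simp: strip_def)
  have "p i * y < v + a" using p_mult_less[OF y(1)] y(2) by (rule order_less_le_trans)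
  then show ?thesis using y p_pos[of i] a_pos by (auto simp: strip_def min_def)
qed

lemma continuous_jump_average:
  assumes "continuous_kernel U"
  shows "continuous_on strip (\<lambda>z. jump_average U (fst z) (snd z) i j)"
proof -
  have "continuous_on strip (\<lambda>z. U (p i * fst z) (min (snd z) (p i * fst z)) k j)" for k
  proof -
    have "continuous_on strip (\<lambda>z. U (fst z) (snd z) k j)"
      using assms by (simp add: continuous_kernel_def)
    moreover have "continuous_on strip (\<lambda>z. (p i * fst z, min (snd z) (p i * fst z)))"
      by (intro continuous_intros)
    moreover have "(\<lambda>z. (p i * fst z, min (snd z) (p i * fst z))) ` strip \<subseteq> strip"
      using after_jump_strip by auto
    ultimately have "continuous_on strip (\<lambda>z. U (fst (p i * fst z, min (snd z) (p i * fst z)))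
        (snd (p i * fst z, min (snd z) (p i * fst z))) k j)"
      by (rule continuous_on_compose2)
    then show ?thesis by simp
  qed
  then show ?thesis unfolding jump_average_def by (intro continuous_intros)
qed

lemma continuous_jump_average_section:
  assumes "continuous_kernel U" "0 < v"
  shows "continuous_on {v..v + a} (\<lambda>y. jump_average U y v i j)"
proof -
  have "(\<lambda>y. (y, v)) ` {v..v + a} \<subseteq> strip" using assms by (auto simp: strip_def)
  from continuous_on_compose2[OF continuous_jump_average[OF assms(1)] _ this]
  show ?thesis by (simp add: continuous_intros)
qed

lemma continuous_integrand:
  assumes "continuous_kernel U" "(x, v) \<in> strip"
  shows "continuous_on {x..v + a} (\<lambda>y. lam i * c i * exp (- decay i * (y - x)) * jump_average U y v i j)"
proof -
  have "continuous_on {x..v + a} (\<lambda>y. jump_average U y v i j)"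
    using assms(2) by (intro continuous_on_subset[OF continuous_jump_average_section[OF assms(1)]]) (auto simp: strip_def)
  then show ?thesis by (intro continuous_intros)
qed

lemma first_jump_unit_interval:
  assumes "continuous_kernel U" "(x, v) \<in> strip"
  shows "first_jump U x v i j = exp (- decay i * (v + a - x)) * of_bool (i = j)
     + (v + a - x) * integral {0..1} (\<lambda>r. lam i * c i * exp (- decay i * (r * (v + a - x)))
         * jump_average U (x + r * (v + a - x)) v i j)"
  using integral_unit_interval[OF _ continuous_integrand[OF assms, of i j]] assms(2)
  by (simp add: first_jump_def strip_def)

lemma continuous_first_jump:
  assumes U: "continuous_kernel U"
  shows "continuous_kernel (first_jump U)"
  unfolding continuous_kernel_def
proof (intro allI)
  fix i j
  let ?l = "\<lambda>z::real \<times> real. snd z + a - fst z"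
  let ?g = "\<lambda>z r. lam i * c i * exp (- decay i * (r * ?l z)) * jump_average U (fst z + r * ?l z) (snd z) i j"
  have "continuous_on (strip \<times> cbox 0 1) (\<lambda>s. jump_average U (fst (fst s) + snd s * ?l (fst s)) (snd (fst s)) i j)"
  proof -
    have "(fst (fst s) + snd s * ?l (fst s), snd (fst s)) \<in> strip" if s: "s \<in> strip \<times> cbox 0 (1::real)" for s
    proof -
      obtain x v r where sx: "s = ((x, v), r)" by (metis prod.collapse)
      have xv: "0 < v" "v \<le> x" "x \<le> v + a" "0 \<le> r" "r \<le> 1" using s by (auto simp: strip_def sx cbox_interval)
      define q where "q = r * (v + a - x)"
      have "q \<le> v + a - x" unfolding q_def using xv by (intro mult_left_le_one_le) auto
      moreover have "0 \<le> q" unfolding q_def using xv by simp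
      ultimately have "(x + q, v) \<in> strip" using xv by (simp add: strip_def)
      then show ?thesis by (simp add: q_def sx)
    qed
    then have "(\<lambda>s. (fst (fst s) + snd s * ?l (fst s), snd (fst s))) ` (strip \<times> cbox 0 1) \<subseteq> strip" by blast
    from continuous_on_compose2[OF continuous_jump_average[OF U, of i j] _ this]
    show ?thesis by (simp add: continuous_intros)
  qed
  then have "continuous_on (strip \<times> cbox 0 1) (\<lambda>(z, r). ?g z r)"
    unfolding case_prod_unfold by (intro continuous_intros)
  then have "continuous_on strip (\<lambda>z. integral (cbox 0 1) (?g z))"
    by (rule integral_continuous_on_param)
  then have "continuous_on strip (\<lambda>z. exp (- decay i * ?l z) * of_bool (i = j) + ?l z * integral {0..1} (?g z))"
    unfolding cbox_interval by (intro continuous_intros)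
  then show "continuous_on strip (\<lambda>z. first_jump U (fst z) (snd z) i j)"
    by (rule continuous_on_cong[THEN iffD1, rotated 2]) (simp_all add: first_jump_unit_interval[OF U])
qed

section \<open>The contraction estimate in the supremum norm\<close>

definition contraction :: real where
  "contraction = Max (range (\<lambda>i. lam i / (w + lam i)))"

lemma contraction_ge: "lam i / (w + lam i) \<le> contraction"
  unfolding contraction_def by (intro Max_ge) auto

lemma contraction_nonneg: "0 \<le> contraction"
proof -
  have "0 \<le> lam i / (w + lam i)" for i using lam_pos[of i] w_pos by simp
  then show ?thesis using contraction_ge order_trans by blast
qed

lemma contraction_less_1: "contraction < 1"
proof -
  have "lam i / (w + lam i) < 1" for i using lam_pos[of i] w_pos by (simp add: field_simps)
  then show ?thesis unfolding contraction_def by (subst Max_less_iff) auto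
qed

text \<open>The mass of the kernel of \<open>first_jump\<close>: \<open>lam i / (w + lam i)\<close>
  times the probability that an exponential time of rate \<open>w + lam i\<close> ends before the
  level \<open>u\<close> is reached.\<close>

lemma has_integral_decay:
  assumes "x \<le> u"
  shows "((\<lambda>y. lam i * c i * exp (- decay i * (y - x))) has_integral
    lam i / (w + lam i) * (1 - exp (- decay i * (u - x)))) {x..u}"
proof -
  define K where "K = lam i / (w + lam i)"
  let ?F = "\<lambda>y. - K * exp (- decay i * (y - x))"
  have c: "K * decay i = lam i * c i"
    using add_pos_pos[OF w_pos lam_pos[of i]] by (simp add: decay_def K_def)
  have "((\<lambda>y. lam i * c i * exp (- decay i * (y - x))) has_integral (?F u - ?F x)) {x..u}"
  proof (rule fundamental_theorem_of_calculus[OF assms])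
    fix y
    have "(?F has_real_derivative K * decay i * exp (- decay i * (y - x))) (at y within {x..u})"
      by (auto intro!: derivative_eq_intros)
    then show "(?F has_vector_derivative lam i * c i * exp (- decay i * (y - x))) (at y within {x..u})"
      unfolding c by (simp add: has_real_derivative_iff_has_vector_derivative)
  qed
  then show ?thesis by (simp add: algebra_simps K_def)
qed

text \<open>The term for passage without a jump does not involve the kernel and cancels. Averaging
  with the stochastic rows of \<open>Q\<close> preserves the bound \<open>M\<close>, and the
  remaining integral has mass at most \<open>contraction\<close>.\<close>

lemma first_jump_contraction:
  assumes U: "continuous_kernel U" and W: "continuous_kernel W"
    and M: "\<And>x v i j. (x, v) \<in> strip \<Longrightarrow> \<bar>U x v i j - W x v i j\<bar> \<le> M"
    and xv: "(x, v) \<in> strip"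
  shows "\<bar>first_jump U x v i j - first_jump W x v i j\<bar> \<le> contraction * M"
proof -
  let ?e = "\<lambda>y. lam i * c i * exp (- decay i * (y - x))"
  let ?f = "\<lambda>U y. ?e y * jump_average U y v i j"
  have int: "?f U integrable_on {x..v + a}" "?f W integrable_on {x..v + a}"
    using continuous_integrand[OF U xv] continuous_integrand[OF W xv]
    by (auto intro: integrable_continuous_real)
  have "x \<le> v + a" using xv by (auto simp: strip_def)
  note e = has_integral_mult_left[OF has_integral_decay[OF this, of i], of M]
  have "0 \<le> M" using M[OF xv, of i j] by linarith
  have "\<bar>jump_average U y v i j - jump_average W y v i j\<bar> \<le> M" if "y \<in> {x..v + a}" for y
  proof -
    have "(y, v) \<in> strip" using that xv by (auto simp: strip_def)
    note d = after_jump_strip[OF this, of i]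
    have "\<bar>jump_average U y v i j - jump_average W y v i j\<bar>
        = \<bar>\<Sum>k\<in>UNIV. Q $ i $ k * (U (p i * y) (min v (p i * y)) k j - W (p i * y) (min v (p i * y)) k j)\<bar>"
      by (simp add: jump_average_def sum_subtractf right_diff_distrib)
    also have "\<dots> \<le> (\<Sum>k\<in>UNIV. Q $ i $ k * \<bar>U (p i * y) (min v (p i * y)) k j - W (p i * y) (min v (p i * y)) k j\<bar>)"
      by (rule order_trans[OF sum_abs]) (simp add: abs_mult Q_nonneg)
    also have "\<dots> \<le> M" by (intro Q_average_le M d)
    finally show ?thesis .
  qed
  note diff = this
  have bound: "norm (?f U y - ?f W y) \<le> ?e y * M" if y: "y \<in> {x..v + a}" for y
  proof -
    have e0: "0 \<le> ?e y" using lam_pos[of i] c_pos[of i] by simp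
    have "norm (?f U y - ?f W y) = ?e y * \<bar>jump_average U y v i j - jump_average W y v i j\<bar>"
      unfolding abs_mult_pos'[OF e0] by (simp add: right_diff_distrib)
    also have "\<dots> \<le> ?e y * M" by (rule mult_left_mono[OF diff[OF y] e0])
    finally show ?thesis .
  qed
  have "\<bar>first_jump U x v i j - first_jump W x v i j\<bar> = norm (integral {x..v + a} (\<lambda>y. ?f U y - ?f W y))"
    unfolding integral_diff[OF int] by (simp add: first_jump_def)
  also have "\<dots> \<le> integral {x..v + a} (\<lambda>y. ?e y * M)"
    using e by (intro integral_norm_bound_integral bound integrable_diff int) auto
  also have "\<dots> = lam i / (w + lam i) * (1 - exp (- decay i * (v + a - x))) * M"
    by (rule integral_unique[OF e])
  also have "\<dots> \<le> lam i / (w + lam i) * 1 * M"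
    by (intro mult_right_mono[OF mult_left_mono] \<open>0 \<le> M\<close> less_imp_le[OF divide_pos_pos] add_pos_pos lam_pos w_pos) simp
  also have "\<dots> \<le> contraction * M" 
    unfolding mult_1_right by (rule mult_right_mono[OF contraction_ge \<open>0 \<le> M\<close>])
  finally show ?thesis .
qed

section \<open>Picard iteration and its fixed point\<close>

definition iterate :: "nat \<Rightarrow> real \<Rightarrow> real \<Rightarrow> 'm \<Rightarrow> 'm \<Rightarrow> real" where
  "iterate n = (first_jump ^^ n) (\<lambda>_ _ _ _. 0)"

lemma iterate_0 [simp]: "iterate 0 = (\<lambda>_ _ _ _. 0)" and iterate_Suc: "iterate (Suc n) = first_jump (iterate n)"
  by (simp_all add: iterate_def)

lemma continuous_iterate: "continuous_kernel (iterate n)"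
  by (induction n) (simp_all add: iterate_Suc continuous_first_jump, simp add: continuous_kernel_def)

lemma iterate_diff:
  "(x, v) \<in> strip \<Longrightarrow> \<bar>iterate (Suc n) x v i j - iterate n x v i j\<bar> \<le> contraction ^ n"
proof (induction n arbitrary: x v i j)
  case 0
  then show ?case using decay_pos[of i] by (auto simp: iterate_Suc first_jump_def jump_average_def strip_def)
next
  case (Suc n)
  show ?case
    using first_jump_contraction[OF continuous_iterate[of "Suc n"] continuous_iterate[of n] Suc.IH Suc.prems]
    by (simp add: iterate_Suc)
qed

text \<open>The limit of the iterates in telescoped form, suited to the Weierstrass M-test with the
  geometric majorant of \<open>iterate_diff\<close>. The partial sums are the iterates themselves
  because \<open>iterate 0\<close> vanishes.\<close>

definition passage_kernel :: "real \<Rightarrow> real \<Rightarrow> 'm \<Rightarrow> 'm \<Rightarrow> real" where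
  "passage_kernel x v i j = (\<Sum>n. iterate (Suc n) x v i j - iterate n x v i j)"

lemma uniform_limit_iterate:
  "uniform_limit strip (\<lambda>n z. iterate n (fst z) (snd z) i j) (\<lambda>z. passage_kernel (fst z) (snd z) i j) sequentially"
proof -
  have "uniform_limit strip (\<lambda>n z. \<Sum>k<n. iterate (Suc k) (fst z) (snd z) i j - iterate k (fst z) (snd z) i j)
     (\<lambda>z. passage_kernel (fst z) (snd z) i j) sequentially"
    unfolding passage_kernel_def
    by (rule Weierstrass_m_test[where M = "\<lambda>n. contraction ^ n"])
       (use iterate_diff contraction_nonneg contraction_less_1 in \<open>auto intro: summable_geometric\<close>)
  moreover have "(\<Sum>k<n. iterate (Suc k) x v i j - iterate k x v i j) = iterate n x v i j" for n x v
    by (subst sum_lessThan_telescope) simp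
  ultimately show ?thesis by simp
qed

lemma continuous_passage_kernel: "continuous_kernel passage_kernel"
  unfolding continuous_kernel_def
proof (intro allI)
  fix i j
  show "continuous_on strip (\<lambda>z. passage_kernel (fst z) (snd z) i j)"
    by (rule uniform_limit_theorem[OF _ uniform_limit_iterate])
       (use continuous_iterate in \<open>auto simp: continuous_kernel_def\<close>)
qed

lemma iterate_tendsto:
  "(x, v) \<in> strip \<Longrightarrow> (\<lambda>n. iterate n x v i j) \<longlonglongrightarrow> passage_kernel x v i j"
  using tendsto_uniform_limitI[OF uniform_limit_iterate, of "(x, v)"] by simp

lemma first_jump_passage_kernel:
  assumes xv: "(x, v) \<in> strip"
  shows "first_jump passage_kernel x v i j = passage_kernel x v i j"
proof -
  have "(\<lambda>n. first_jump (iterate n) x v i j) \<longlonglongrightarrow> first_jump passage_kernel x v i j"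
  proof (rule LIMSEQ_I)
    fix e :: real assume e: "0 < e"
    \<comment> \<open>The operator mixes the rows, so one index must serve all phases at once;
      finiteness of the phase set makes this possible.\<close>
    have "\<forall>\<^sub>F n in sequentially. \<forall>i\<in>UNIV. \<forall>j\<in>UNIV. \<forall>z\<in>strip. dist (iterate n (fst z) (snd z) i j) (passage_kernel (fst z) (snd z) i j) < e"
      using uniform_limitD[OF uniform_limit_iterate e] by (intro eventually_ball_finite[OF finite[of UNIV]] ballI)
    then obtain n0 where *: "\<forall>n\<ge>n0. \<forall>i\<in>UNIV. \<forall>j\<in>UNIV. \<forall>z\<in>strip. dist (iterate n (fst z) (snd z) i j) (passage_kernel (fst z) (snd z) i j) < e"
      unfolding eventually_sequentially by blast
    have n0: "\<bar>iterate n x v i j - passage_kernel x v i j\<bar> \<le> e" if "n \<ge> n0" "(x, v) \<in> strip" for n x v i j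
      using *[rule_format, OF that(1) UNIV_I UNIV_I that(2), of i j] by (simp add: dist_real_def)
    have "norm (first_jump (iterate n) x v i j - first_jump passage_kernel x v i j) < e" if "n \<ge> n0" for n
    proof -
      have "\<bar>first_jump (iterate n) x v i j - first_jump passage_kernel x v i j\<bar> \<le> contraction * e"
        using that by (intro first_jump_contraction continuous_iterate continuous_passage_kernel n0 xv)
      also have "\<dots> < e" using contraction_less_1 e by simp
      finally show ?thesis by simp
    qed
    then show "\<exists>n0. \<forall>n\<ge>n0. norm (first_jump (iterate n) x v i j - first_jump passage_kernel x v i j) < e" by blast
  qed
  moreover have "(\<lambda>n. first_jump (iterate n) x v i j) \<longlonglongrightarrow> passage_kernel x v i j"
    using LIMSEQ_Suc[OF iterate_tendsto[OF xv, of i j]] by (simp add: iterate_Suc)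
  ultimately show ?thesis by (rule LIMSEQ_unique)
qed

lemma jump_average_nonneg:
  assumes "\<And>x v k. (x, v) \<in> strip \<Longrightarrow> 0 \<le> U x v k j" "(y, v) \<in> strip"
  shows "0 \<le> jump_average U y v i j"
  unfolding jump_average_def by (intro sum_nonneg mult_nonneg_nonneg Q_nonneg assms after_jump_strip)

text \<open>Needed because expectations are computed in \<open>ennreal\<close>, where
  \<open>ennreal\<close> is compatible with sums and products only for nonnegative reals.\<close>

lemma iterate_nonneg: "(x, v) \<in> strip \<Longrightarrow> 0 \<le> iterate n x v i j"
proof (induction n arbitrary: x v i j)
  case (Suc n)
  have "0 \<le> lam i * c i * exp (- decay i * (y - x)) * jump_average (iterate n) y v i j" if "y \<in> {x..v + a}" for y
    using that Suc.prems lam_pos[of i] c_pos[of i]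
    by (intro mult_nonneg_nonneg jump_average_nonneg Suc.IH) (auto simp: strip_def)
  then have "0 \<le> integral {x..v + a} (\<lambda>y. lam i * c i * exp (- decay i * (y - x)) * jump_average (iterate n) y v i j)"
    by (intro integral_nonneg integrable_continuous_real continuous_integrand continuous_iterate Suc.prems) auto
  then show ?case by (simp add: iterate_Suc first_jump_def)
qed simp

end

section \<open>The passage transform as a limit of Picard iterates\<close>

context drop_process
begin

section \<open>Almost every path is regular: positive holding times and no explosion\<close>

lemma AE_hold_pos: "AE \<omega> in noise_law. \<forall>n i. 0 < fst (\<omega> n i)"
proof -
  have "AE h in density lborel (exponential_density (lam i)). 0 < h" for i
    using AE_lborel_singleton[of "0::real"]
    by (subst AE_density) (auto simp: exponential_density_def elim!: eventually_mono)
  moreover have "distr (jump_law i) (density lborel (exponential_density (lam i))) fst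
      = density lborel (exponential_density (lam i))" for i
    unfolding jump_law_def by (rule prob_space.distr_pair_fst[OF prob_space_next_phase])
  moreover have "fst \<in> jump_law i \<rightarrow>\<^sub>M density lborel (exponential_density (lam i))" for i
    unfolding jump_law_def by (rule measurable_fst)
  ultimately have "AE z in jump_law i. 0 < fst z" for i
    by (metis AE_distrD)
  then have "AE y in step_law. 0 < fst (y i)" for i
    unfolding step_law_def by (intro AE_PiM_component[where P = "\<lambda>z. 0 < fst z"] prob_space_jump_law) auto
  then have "AE \<omega> in noise_law. 0 < fst (\<omega> n i)" for n i
    unfolding noise_law_eq by (intro AE_PiM_component[where P = "\<lambda>y. 0 < fst (y i)"] prob_space_step_law) auto
  then show ?thesis by (simp add: AE_all_countable)
qed

lemma measurable_phase: "(\<lambda>\<omega>. phase i \<omega> n) \<in> noise_law \<rightarrow>\<^sub>M count_space UNIV"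
proof (induction n)
  case (Suc n)
  show ?case unfolding phase.simps
    by (rule measurable_compose_countable[OF _ Suc], rule measurable_jump_compose(2)[where s = "\<lambda>\<omega>. \<omega>"]) simp
qed simp

lemma measurable_jump_time: "(\<lambda>\<omega>. jump_time i \<omega> n) \<in> borel_measurable noise_law"
proof -
  have "(\<lambda>\<omega>. hold i \<omega> n) \<in> borel_measurable noise_law" for n
    unfolding hold_def
    by (rule measurable_compose_countable[OF _ measurable_phase], rule measurable_jump_compose(1)[where s = "\<lambda>\<omega>. \<omega>"]) simp
  then show ?thesis unfolding jump_time_def by (intro borel_measurable_sum)
qed

text \<open>Discounting the exponential density of rate \<open>lam i\<close> by
  \<open>exp (- w * h)\<close> gives \<open>lam i / (w + lam i)\<close> times the density of rate
  \<open>w + lam i\<close>, which integrates to 1.\<close>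

lemma nn_integral_discounted_density:
  "(\<integral>\<^sup>+h. ennreal (exponential_density (lam i) h) * ennreal (exp (- w * h)) \<partial>lborel) = ennreal (lam i / (w + lam i))"
proof -
  have pos: "0 < w + lam i" using w_pos lam_pos[of i] by simp
  have "ennreal (exponential_density (lam i) h) * ennreal (exp (- w * h))
     = ennreal (lam i / (w + lam i)) * ennreal (exponential_density (w + lam i) h)" for h
  proof -
    have "exp (- h * lam i) * exp (- w * h) = exp (- h * (w + lam i))"
      by (simp add: exp_add[symmetric] algebra_simps)
    then have "exponential_density (lam i) h * exp (- w * h) = lam i / (w + lam i) * exponential_density (w + lam i) h"
      using pos by (simp add: exponential_density_def)
    then show ?thesis using pos lam_pos[of i]
      by (simp add: ennreal_mult'[symmetric] ennreal_mult''[symmetric])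
  qed
  then have "(\<integral>\<^sup>+h. ennreal (exponential_density (lam i) h) * ennreal (exp (- w * h)) \<partial>lborel)
      = ennreal (lam i / (w + lam i)) * (\<integral>\<^sup>+h. ennreal (exponential_density (w + lam i) h) \<partial>lborel)"
    by (simp add: nn_integral_cmult)
  also have "(\<integral>\<^sup>+h. ennreal (exponential_density (w + lam i) h) \<partial>lborel) = 1"
    using prob_space.emeasure_space_1[OF prob_space_exponential_density[OF pos]]
    by (simp add: emeasure_density)
  finally show ?thesis by simp
qed

lemma Q_ennreal_sum: "(\<Sum>k\<in>UNIV. ennreal (Q $ i $ k)) = 1"
  using Q_nonneg Q_sum by (simp add: sum_ennreal)

text \<open>Each jump contributes an expected discount of at most \<open>contraction\<close>,
  whatever the current phase. The induction generalises over the initial phase because the shifted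
  path starts in the phase chosen at the jump.\<close>

lemma nn_integral_exp_jump_time_le:
  "(\<integral>\<^sup>+\<omega>. ennreal (exp (- w * jump_time i \<omega> n)) \<partial>noise_law) \<le> ennreal (contraction ^ n)"
proof (induction n arbitrary: i)
  case 0
  then show ?case using prob_space.emeasure_space_1[OF prob_space_noise_law]
    by (simp add: jump_time_def)
next
  case (Suc n)
  let ?f = "\<lambda>k h \<omega>. ennreal (exp (- w * h)) * ennreal (exp (- w * jump_time k \<omega> n))"
  have [measurable]: "(\<lambda>\<omega>. jump_time k \<omega> n) \<in> borel_measurable noise_law" for k
    by (rule measurable_jump_time)
  have "jump_time i \<omega> (Suc n) = fst (\<omega> 0 i) + jump_time (snd (\<omega> 0 i)) (\<lambda>n. \<omega> (Suc n)) n" for \<omega>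
    using jump_time_case_nat_Suc[of i "\<omega> 0" "\<lambda>n. \<omega> (Suc n)" n] by (simp add: case_nat_shift)
  then have "ennreal (exp (- w * jump_time i \<omega> (Suc n))) = ?f (snd (\<omega> 0 i)) (fst (\<omega> 0 i)) (\<lambda>n. \<omega> (Suc n))" for \<omega>
    by (simp add: ennreal_mult'[symmetric] exp_add[symmetric] algebra_simps)
  then have "(\<integral>\<^sup>+\<omega>. ennreal (exp (- w * jump_time i \<omega> (Suc n))) \<partial>noise_law)
      = (\<integral>\<^sup>+\<omega>. ?f (snd (\<omega> 0 i)) (fst (\<omega> 0 i)) (\<lambda>n. \<omega> (Suc n)) \<partial>noise_law)"
    by (simp only:)
  also have "\<dots> = (\<integral>\<^sup>+h. ennreal (exponential_density (lam i) h)
      * (\<Sum>k\<in>UNIV. ennreal (Q $ i $ k) * (\<integral>\<^sup>+\<omega>. ?f k h \<omega> \<partial>noise_law)) \<partial>lborel)"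
    by (rule nn_integral_first_jump) measurable
  also have "\<dots> \<le> (\<integral>\<^sup>+h. ennreal (exponential_density (lam i) h) * ennreal (exp (- w * h)) * ennreal (contraction ^ n) \<partial>lborel)"
  proof (rule nn_integral_mono)
    fix h
    have "(\<Sum>k\<in>UNIV. ennreal (Q $ i $ k) * (\<integral>\<^sup>+\<omega>. ?f k h \<omega> \<partial>noise_law))
      = (\<Sum>k\<in>UNIV. ennreal (Q $ i $ k) * (ennreal (exp (- w * h)) * (\<integral>\<^sup>+\<omega>. ennreal (exp (- w * jump_time k \<omega> n)) \<partial>noise_law)))"
      by (simp add: nn_integral_cmult)
    also have "\<dots> \<le> (\<Sum>k\<in>UNIV. ennreal (Q $ i $ k) * (ennreal (exp (- w * h)) * ennreal (contraction ^ n)))"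
      by (intro sum_mono mult_left_mono Suc.IH) auto
    also have "\<dots> = ennreal (exp (- w * h)) * ennreal (contraction ^ n)"
      by (simp only: sum_distrib_right[symmetric] Q_ennreal_sum mult_1_left)
    finally show "ennreal (exponential_density (lam i) h) * (\<Sum>k\<in>UNIV. ennreal (Q $ i $ k) * (\<integral>\<^sup>+\<omega>. ?f k h \<omega> \<partial>noise_law))
      \<le> ennreal (exponential_density (lam i) h) * ennreal (exp (- w * h)) * ennreal (contraction ^ n)"
      unfolding mult.assoc by (rule mult_left_mono) simp
  qed
  also have "\<dots> = ennreal (lam i / (w + lam i)) * ennreal (contraction ^ n)"
    by (simp add: nn_integral_multc nn_integral_discounted_density[simplified])
  also have "\<dots> \<le> ennreal contraction * ennreal (contraction ^ n)"
    by (intro mult_right_mono ennreal_leI contraction_ge) simp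
  also have "\<dots> = ennreal (contraction ^ Suc n)"
    using contraction_nonneg by (simp add: ennreal_mult')
  finally show ?case .
qed

text \<open>Markov's inequality: where all jump times stay below \<open>m\<close>, each discount is
  at least \<open>exp (- w * m)\<close>, while its expectation tends to 0 as the jump number grows.
  Restricting \<open>m\<close> to natural numbers keeps the exceptional sets countable.\<close>

lemma AE_no_explosion: "AE \<omega> in noise_law. \<forall>m::nat. \<exists>n. real m < jump_time i \<omega> n"
  unfolding AE_all_countable
proof
  fix m :: nat
  define A where "A = {\<omega> \<in> space noise_law. \<forall>n. jump_time i \<omega> n \<le> real m}"
  have A: "A \<in> sets noise_law"
    unfolding A_def using measurable_jump_time[of i] by measurable
  have "ennreal (exp (- w * real m)) * emeasure noise_law A \<le> ennreal (contraction ^ n)" for n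
  proof -
    have "ennreal (exp (- w * real m)) * emeasure noise_law A = (\<integral>\<^sup>+\<omega>. ennreal (exp (- w * real m)) * indicator A \<omega> \<partial>noise_law)"
      using A by (simp add: nn_integral_cmult_indicator)
    also have "\<dots> \<le> (\<integral>\<^sup>+\<omega>. ennreal (exp (- w * jump_time i \<omega> n)) \<partial>noise_law)"
      using w_pos by (intro nn_integral_mono) (auto simp: A_def indicator_def)
    also have "\<dots> \<le> ennreal (contraction ^ n)" by (rule nn_integral_exp_jump_time_le)
    finally show ?thesis .
  qed
  moreover have "(\<lambda>n. ennreal (contraction ^ n)) \<longlonglongrightarrow> ennreal 0"
    using contraction_nonneg contraction_less_1 by (intro tendsto_ennrealI LIMSEQ_power_zero) auto
  ultimately have "ennreal (exp (- w * real m)) * emeasure noise_law A \<le> 0"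
    using LIMSEQ_le_const by (metis ennreal_0)
  then have "A \<in> null_sets noise_law" using A by auto
  then show "AE \<omega> in noise_law. \<exists>n. real m < jump_time i \<omega> n"
    by (rule AE_I') (auto simp: A_def not_less)
qed

lemma AE_regular: "AE \<omega> in noise_law. regular i \<omega>"
  using AE_hold_pos AE_no_explosion[of i]
proof eventually_elim
  case (elim \<omega>)
  show ?case unfolding regular_def
  proof (intro conjI allI)
    show "0 < hold i \<omega> n" for n using elim by (simp add: hold_def)
    fix B :: real
    obtain m :: nat where "B < real m" using reals_Archimedean2 by blast
    then show "\<exists>n. B < jump_time i \<omega> n" using elim by (meson less_trans)
  qed
qed

section \<open>Truncated expectations as Picard iterates\<close>

lemma nn_integral_density_tail:
  assumes "0 \<le> d"
  shows "(\<integral>\<^sup>+h. ennreal (exponential_density (lam i) h) * indicator {d<..} h \<partial>lborel) = ennreal (exp (- lam i * d))"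
proof -
  let ?D = "density lborel (exponential_density (lam i))"
  interpret D: prob_space ?D using lam_pos by (rule prob_space_exponential_density)
  have "distributed ?D lborel (\<lambda>x. x) (exponential_density (lam i))"
    by (simp add: distributed_def distr_id2 sets_eq_imp_space_eq)
  from D.exponential_distributedD_gt[OF this assms lam_pos]
  have "measure ?D {d<..} = exp (- d * lam i)" by (simp add: greaterThan_def)
  then have "emeasure ?D {d<..} = ennreal (exp (- lam i * d))"
    by (simp add: D.emeasure_eq_measure mult.commute)
  then show ?thesis by (simp add: emeasure_density)
qed

lemma level_before_jump:
  assumes "h \<in> {0..c i * (v + a - x)}"
  shows "x + h / c i \<in> {x..v + a}"
proof -
  have "h / c i \<le> v + a - x" using assms c_pos[of i] by (simp add: divide_le_eq mult.commute)
  then show ?thesis using assms c_pos[of i] by simp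
qed

text \<open>Conditioning produces an integral over the holding time \<open>h\<close>, while
  \<open>first_jump\<close> integrates over the level \<open>y = x + h / c i\<close>. Both are
  pulled back to \<open>{0..1}\<close>, where the definition of \<open>decay\<close> makes the
  integrands equal.\<close>

lemma first_jump_holding_time:
  fixes i j :: 'm
  assumes U: "continuous_kernel U" and xv: "(x, v) \<in> strip"
  defines "g \<equiv> \<lambda>h. lam i * exp (- (w + lam i) * h) * jump_average U (x + h / c i) v i j"
  shows "continuous_on {0..c i * (v + a - x)} g"
    and "first_jump U x v i j = exp (- decay i * (v + a - x)) * of_bool (i = j) + integral {0..c i * (v + a - x)} g"
proof -
  have l: "0 \<le> v + a - x" "0 < v" "v \<le> x" using xv by (auto simp: strip_def)
  have d: "0 \<le> c i * (v + a - x)" using l c_pos[of i] by simp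
  have "continuous_on {0..c i * (v + a - x)} (\<lambda>h. jump_average U (x + h / c i) v i j)"
  proof (rule continuous_on_compose2[OF continuous_jump_average_section[OF U l(2)]])
    show "continuous_on {0..c i * (v + a - x)} (\<lambda>h. x + h / c i)"
      using c_pos[of i] by (intro continuous_intros) auto
    show "(\<lambda>h. x + h / c i) ` {0..c i * (v + a - x)} \<subseteq> {v..v + a}"
      using level_before_jump[of _ i v x] l(3) by fastforce
  qed
  then show g: "continuous_on {0..c i * (v + a - x)} g"
    unfolding g_def by (intro continuous_intros)
  have "integral {0..c i * (v + a - x)} g
      = (v + a - x) * integral {0..1} (\<lambda>r. c i * g (r * (c i * (v + a - x))))"
    using integral_unit_interval[OF d g] by (simp add: mult_ac)
  also have "(\<lambda>r. c i * g (r * (c i * (v + a - x)))) = (\<lambda>r. lam i * c i * exp (- decay i * (r * (v + a - x)))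
         * jump_average U (x + r * (v + a - x)) v i j)"
  proof
    fix r
    have "- (w + lam i) * (r * (c i * (v + a - x))) = - decay i * (r * (v + a - x))"
      by (simp add: decay_def algebra_simps)
    moreover have "r * (c i * (v + a - x)) / c i = r * (v + a - x)" using c_pos[of i] by simp
    ultimately show "c i * g (r * (c i * (v + a - x))) = lam i * c i * exp (- decay i * (r * (v + a - x)))
         * jump_average U (x + r * (v + a - x)) v i j"
      unfolding g_def by (simp only:) (simp only: mult_ac)
  qed
  finally show "first_jump U x v i j = exp (- decay i * (v + a - x)) * of_bool (i = j) + integral {0..c i * (v + a - x)} g"
    using first_jump_unit_interval[OF U xv] by simp
qed

text \<open>Conditioning on the first jump turns the recursion of \<open>passage_upto\<close> into
  that of \<open>iterate\<close>. No jump before time \<open>d = c i * (v + a - x)\<close> has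
  probability \<open>exp (- lam i * d)\<close>, which with the discount \<open>exp (- w * d)\<close>
  is the first term of \<open>first_jump\<close>. For a jump by time \<open>d\<close>, the induction
  hypothesis applies at the new state, admissible by \<open>jump_domain\<close>.\<close>

lemma nn_integral_passage_upto:
  assumes "0 < v" "v \<le> x" "x < v + a"
  shows "(\<integral>\<^sup>+\<omega>. passage_upto n x v i j \<omega> \<partial>noise_law) = ennreal (iterate n x v i j)"
  using assms
proof (induction n arbitrary: x v i)
  case (Suc n)
  let ?d = "c i * (v + a - x)"
  let ?x' = "\<lambda>h. p i * (x + h / c i)"
  let ?C = "ennreal (exp (- w * ?d)) * of_bool (i = j)"
  let ?f = "\<lambda>k h \<omega>. if ?d < h then ?C
     else ennreal (exp (- w * h)) * passage_upto n (?x' h) (min v (?x' h)) k j \<omega>"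
  define g where "g = (\<lambda>h. lam i * exp (- (w + lam i) * h) * jump_average (iterate n) (x + h / c i) v i j)"
  have xv: "(x, v) \<in> strip" using Suc.prems by (simp add: strip_def)
  have d: "0 \<le> ?d" using Suc.prems c_pos[of i] by simp
  note hold = first_jump_holding_time[OF continuous_iterate[of n] xv, of i j, folded g_def]
  have g_nonneg: "0 \<le> g h" if h: "h \<in> {0..?d}" for h
  proof -
    have "(x + h / c i, v) \<in> strip"
      using level_before_jump[OF h] Suc.prems by (simp add: strip_def)
    then show "0 \<le> g h"
      unfolding g_def using lam_pos[of i] by (intro mult_nonneg_nonneg jump_average_nonneg iterate_nonneg) auto
  qed
  have meas: "(\<lambda>z. passage_upto n (?x' (fst z)) (min v (?x' (fst z))) k j (snd z)) \<in> borel_measurable (borel \<Otimes>\<^sub>M noise_law)" for k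
    by (rule measurable_passage_upto) measurable
  have "passage_upto (Suc n) x v i j \<omega> = ?f (snd (\<omega> 0 i)) (fst (\<omega> 0 i)) (\<lambda>n. \<omega> (Suc n))" for \<omega>
    by simp
  then have "(\<integral>\<^sup>+\<omega>. passage_upto (Suc n) x v i j \<omega> \<partial>noise_law)
      = (\<integral>\<^sup>+\<omega>. ?f (snd (\<omega> 0 i)) (fst (\<omega> 0 i)) (\<lambda>n. \<omega> (Suc n)) \<partial>noise_law)"
    by (simp only:)
  also have "\<dots> = (\<integral>\<^sup>+h. ennreal (exponential_density (lam i) h)
      * (\<Sum>k\<in>UNIV. ennreal (Q $ i $ k) * (\<integral>\<^sup>+\<omega>. ?f k h \<omega> \<partial>noise_law)) \<partial>lborel)"
  proof (rule nn_integral_first_jump)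
    fix k
    note [measurable] = meas[of k]
    show "(\<lambda>(h, \<omega>). ?f k h \<omega>) \<in> borel_measurable (borel \<Otimes>\<^sub>M noise_law)"
      unfolding case_prod_unfold by measurable
  qed
  also have "\<dots> = (\<integral>\<^sup>+h. ?C * (ennreal (exponential_density (lam i) h) * indicator {?d<..} h)
      + ennreal (g h) * indicator {0..?d} h \<partial>lborel)"
  proof (rule nn_integral_cong)
    fix h :: real
    consider "h < 0" | "0 \<le> h" "h \<le> ?d" | "?d < h" by linarith
    then show "ennreal (exponential_density (lam i) h)
      * (\<Sum>k\<in>UNIV. ennreal (Q $ i $ k) * (\<integral>\<^sup>+\<omega>. ?f k h \<omega> \<partial>noise_law))
      = ?C * (ennreal (exponential_density (lam i) h) * indicator {?d<..} h) + ennreal (g h) * indicator {0..?d} h"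
    proof cases
      case 1
      then show ?thesis by (simp add: exponential_density_def)
    next
      case 3
      then have "(\<integral>\<^sup>+\<omega>. ?f k h \<omega> \<partial>noise_law) = ?C" for k
        using prob_space.emeasure_space_1[OF prob_space_noise_law] by simp
      then have "(\<Sum>k\<in>UNIV. ennreal (Q $ i $ k) * (\<integral>\<^sup>+\<omega>. ?f k h \<omega> \<partial>noise_law)) = ?C"
        by (simp only: sum_distrib_right[symmetric] Q_ennreal_sum mult_1_left)
      then show ?thesis using 3 d by (simp add: mult_ac)
    next
      case 2
      let ?R = "\<lambda>k. iterate n (?x' h) (min v (?x' h)) k j"
      note dom = jump_domain[OF Suc.prems 2]
      have "(?x' h, min v (?x' h)) \<in> strip" using dom by (simp add: strip_def)
      then have R: "0 \<le> ?R k" for k by (rule iterate_nonneg)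
      have [measurable]: "passage_upto n (?x' h) (min v (?x' h)) k j \<in> borel_measurable noise_law" for k
        using measurable_passage_upto[of "\<lambda>_. ?x' h" noise_law "\<lambda>_. min v (?x' h)" "\<lambda>\<omega>. \<omega>"] by simp
      have "(\<integral>\<^sup>+\<omega>. ?f k h \<omega> \<partial>noise_law) = ennreal (exp (- w * h)) * ennreal (?R k)" for k
        using 2 Suc.IH[OF dom] by (simp add: nn_integral_cmult not_less)
      then have "ennreal (Q $ i $ k) * (\<integral>\<^sup>+\<omega>. ?f k h \<omega> \<partial>noise_law) = ennreal (exp (- w * h) * (Q $ i $ k * ?R k))" for k
        using R Q_nonneg by (simp only:) (simp add: ennreal_mult[symmetric] mult_ac)
      then have "(\<Sum>k\<in>UNIV. ennreal (Q $ i $ k) * (\<integral>\<^sup>+\<omega>. ?f k h \<omega> \<partial>noise_law))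
          = ennreal (exp (- w * h) * jump_average (iterate n) (x + h / c i) v i j)"
        using R Q_nonneg by (simp only: jump_average_def sum_distrib_left) (simp add: sum_ennreal)
      moreover have "exponential_density (lam i) h * (exp (- w * h) * jump_average (iterate n) (x + h / c i) v i j) = g h"
        using 2 by (simp add: g_def exponential_density_def exp_add[symmetric] algebra_simps)
      moreover have "0 \<le> exponential_density (lam i) h" by (rule exponential_density_nonneg[OF lam_pos])
      ultimately have "ennreal (exponential_density (lam i) h)
          * (\<Sum>k\<in>UNIV. ennreal (Q $ i $ k) * (\<integral>\<^sup>+\<omega>. ?f k h \<omega> \<partial>noise_law)) = ennreal (g h)"
        by (simp only: ennreal_mult'[symmetric])
      then show ?thesis using 2 by simp
    qed
  qed
  also have "\<dots> = ?C * (\<integral>\<^sup>+h. ennreal (exponential_density (lam i) h) * indicator {?d<..} h \<partial>lborel)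
      + (\<integral>\<^sup>+h. ennreal (g h) * indicator {0..?d} h \<partial>lborel)"
  proof -
    \<comment> \<open>Continuity of \<open>g\<close> is available only on the closed interval, so
      measurability is established for \<open>g\<close> cut off by the indicator.\<close>
    have "(\<lambda>h. indicator {0..?d} h *\<^sub>R g h) \<in> borel_measurable borel"
      by (rule borel_measurable_continuous_on_indicator[OF _ hold(1)]) simp
    then have "(\<lambda>h. ennreal (indicator {0..?d} h *\<^sub>R g h)) \<in> borel_measurable borel" by measurable
    also have "(\<lambda>h. ennreal (indicator {0..?d} h *\<^sub>R g h)) = (\<lambda>h. ennreal (g h) * indicator {0..?d} h)"
      by (auto simp: indicator_def)
    finally have [measurable]: "(\<lambda>h. ennreal (g h) * indicator {0..?d} h) \<in> borel_measurable borel" .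
    show ?thesis by (subst nn_integral_add) (simp_all add: nn_integral_cmult)
  qed
  also have "(\<integral>\<^sup>+h. ennreal (g h) * indicator {0..?d} h \<partial>lborel) = ennreal (integral {0..?d} g)"
  proof (rule nn_integral_has_integral_lebesgue')
    show "(g has_integral integral {0..?d} g) {0..?d}"
      by (intro integrable_integral integrable_continuous_real hold(1))
    show "0 \<le> g h" if "h \<in> {0..?d}" for h by (rule g_nonneg[OF that])
  qed
  also have "?C * (\<integral>\<^sup>+h. ennreal (exponential_density (lam i) h) * indicator {?d<..} h \<partial>lborel)
      = ennreal (exp (- decay i * (v + a - x)) * of_bool (i = j))"
  proof -
    have "exp (- w * ?d) * exp (- lam i * ?d) = exp (- decay i * (v + a - x))"
      by (simp add: exp_add[symmetric] decay_def algebra_simps)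
    then show ?thesis
      unfolding nn_integral_density_tail[OF d] by (auto simp: ennreal_mult[symmetric])
  qed
  also have "ennreal (exp (- decay i * (v + a - x)) * of_bool (i = j)) + ennreal (integral {0..?d} g)
      = ennreal (iterate (Suc n) x v i j)"
    unfolding iterate_Suc hold(2)
  proof (rule ennreal_plus[symmetric])
    show "0 \<le> integral {0..?d} g"
      using g_nonneg
      by (intro integral_nonneg integrable_continuous_real hold(1))
  qed simp
  finally show ?case .
next
  case 0
  have "passage_upto 0 x v i j = (\<lambda>_. 0)" by (simp add: fun_eq_iff)
  then show ?case by simp
qed

lemma passage_transform_eq:
  assumes "0 < v" "v \<le> x" "x < v + a"
  shows "passage_transform c lam p Q w a x v i j = passage_kernel x v i j"
proof -
  have xv: "(x, v) \<in> strip" using assms by (simp add: strip_def)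
  have [measurable]: "passage_upto n x v i j \<in> borel_measurable noise_law" for n
    using measurable_passage_upto[of "\<lambda>_. x" noise_law "\<lambda>_. v" "\<lambda>\<omega>. \<omega>"] by simp
  have mono: "incseq (\<lambda>n. passage_upto n x v i j)"
    by (intro incseq_SucI le_funI passage_upto_Suc_ge)
  have "(\<integral>\<^sup>+\<omega>. passage_functional x v i j \<omega> \<partial>noise_law)
      = (\<integral>\<^sup>+\<omega>. (SUP n. passage_upto n x v i j \<omega>) \<partial>noise_law)"
    using AE_regular[of i] passage_functional_eq_SUP[OF _ assms]
    by (intro nn_integral_cong_AE) (auto elim!: eventually_mono)
  also have "\<dots> = (SUP n. ennreal (iterate n x v i j))"
    by (subst nn_integral_monotone_convergence_SUP[OF mono]) (simp_all add: nn_integral_passage_upto assms)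
  also have "\<dots> = ennreal (passage_kernel x v i j)"
  proof (rule LIMSEQ_unique)
    have "incseq (\<lambda>n. \<integral>\<^sup>+\<omega>. passage_upto n x v i j \<omega> \<partial>noise_law)"
      by (intro incseq_SucI nn_integral_mono passage_upto_Suc_ge)
    then show "(\<lambda>n. ennreal (iterate n x v i j)) \<longlonglongrightarrow> (SUP n. ennreal (iterate n x v i j))"
      by (intro LIMSEQ_SUP) (simp add: nn_integral_passage_upto assms)
    show "(\<lambda>n. ennreal (iterate n x v i j)) \<longlonglongrightarrow> ennreal (passage_kernel x v i j)"
      by (intro tendsto_ennrealI iterate_tendsto xv)
  qed
  finally have "(\<integral>\<^sup>+\<omega>. passage_functional x v i j \<omega> \<partial>noise_law) = ennreal (passage_kernel x v i j)" .
  \<comment> \<open>\<open>enn2real\<close> recovers a real number from \<open>ennreal\<close> only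
    when that number is nonnegative.\<close>
  moreover have "0 \<le> passage_kernel x v i j"
    by (rule LIMSEQ_le_const[OF iterate_tendsto[OF xv]]) (use iterate_nonneg[OF xv] in auto)
  ultimately show ?thesis
    by (simp add: passage_transform_def passage_functional_def)
qed

end

section \<open>The passage transform solves the boundary value problem\<close>

lemma has_vector_derivative_vec_lambda:
  fixes f :: "'n::finite \<Rightarrow> real \<Rightarrow> real"
  assumes "\<And>j. (f j has_real_derivative D j) (at x within S)"
  shows "((\<lambda>x. \<chi> j. f j x) has_vector_derivative (\<chi> j. D j)) (at x within S)"
  unfolding has_vector_derivative_def
proof (subst has_derivative_componentwise_within, intro ballI)
  fix b :: "real ^ 'n" assume "b \<in> Basis"
  then obtain j where b: "b = axis j 1" by (auto simp: Basis_vec_def)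
  have "(f j has_derivative (\<lambda>h. h * D j)) (at x within S)"
    using assms[of j] by (simp add: has_field_derivative_def mult.commute[of _ "D j"])
  then show "((\<lambda>x. (\<chi> j. f j x) \<bullet> b) has_derivative (\<lambda>h. (h *\<^sub>R (\<chi> j. D j)) \<bullet> b)) (at x within S)"
    by (simp add: b inner_axis)
qed

context drop_process
begin

text \<open>Factoring \<open>exp (decay i * x)\<close> out of the fixed point equation leaves
  \<open>x\<close> only in the lower limit of an integral with a continuous integrand; the product
  rule and the fundamental theorem of calculus do the rest. The derivative is taken within the
  closed interval so that its endpoints are covered too.\<close>

lemma passage_kernel_deriv:
  assumes v: "0 < v" and x: "x \<in> {v..v + a}"
  shows "((\<lambda>x. passage_kernel x v i j) has_real_derivative
     decay i * passage_kernel x v i j - lam i * c i * jump_average passage_kernel x v i j) (at x within {v..v + a})"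
proof -
  let ?A = "\<lambda>y. jump_average passage_kernel y v i j"
  let ?h = "\<lambda>y. lam i * c i * exp (- decay i * y) * ?A y"
  have cont: "continuous_on {v..v + a} ?h"
    by (intro continuous_intros continuous_jump_average_section continuous_passage_kernel v)
  have eq: "passage_kernel y v i j = exp (decay i * y) *
      (exp (- decay i * (v + a)) * of_bool (i = j) + integral {y..v + a} ?h)" if y: "y \<in> {v..v + a}" for y
  proof -
    have yv: "(y, v) \<in> strip" using y v by (simp add: strip_def)
    have "passage_kernel y v i j = first_jump passage_kernel y v i j"
      using first_jump_passage_kernel[OF yv] by simp
    also have "\<dots> = exp (- decay i * (v + a - y)) * of_bool (i = j)
        + integral {y..v + a} (\<lambda>z. exp (decay i * y) * ?h z)"
    proof -
      have "exp (- decay i * (z - y)) = exp (decay i * y) * exp (- decay i * z)" for z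
        by (simp add: exp_add[symmetric] algebra_simps)
      then show ?thesis by (simp only: first_jump_def mult_ac)
    qed
    also have "\<dots> = exp (decay i * y) * (exp (- decay i * (v + a)) * of_bool (i = j) + integral {y..v + a} ?h)"
    proof -
      have "exp (- decay i * (v + a - y)) = exp (decay i * y) * exp (- decay i * (v + a))"
        by (simp add: exp_add[symmetric] algebra_simps)
      then show ?thesis by (simp only: integral_mult_right distrib_left mult.assoc)
    qed
    finally show ?thesis .
  qed
  have int: "((\<lambda>y. integral {y..v + a} ?h) has_real_derivative - ?h x) (at x within {v..v + a})"
    using integral_has_real_derivative'[OF cont x] .
  have e: "exp (decay i * x) * exp (- decay i * x) = 1"
    by (simp add: exp_add[symmetric])
  have "((\<lambda>y. exp (decay i * y) * (exp (- decay i * (v + a)) * of_bool (i = j) + integral {y..v + a} ?h))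
      has_real_derivative
      decay i * passage_kernel x v i j - lam i * c i * ?A x) (at x within {v..v + a})"
  proof (rule DERIV_cong)
    show "((\<lambda>y. exp (decay i * y) * (exp (- decay i * (v + a)) * of_bool (i = j) + integral {y..v + a} ?h))
      has_real_derivative exp (decay i * x) * decay i * (exp (- decay i * (v + a)) * of_bool (i = j) + integral {x..v + a} ?h)
        + exp (decay i * x) * - ?h x) (at x within {v..v + a})"
      by (rule derivative_eq_intros int refl)+ simp
    have "exp (decay i * x) * - ?h x = - (exp (decay i * x) * exp (- decay i * x)) * (lam i * c i * ?A x)"
      by (simp add: mult_ac)
    then show "exp (decay i * x) * decay i * (exp (- decay i * (v + a)) * of_bool (i = j) + integral {x..v + a} ?h)
        + exp (decay i * x) * - ?h x = decay i * passage_kernel x v i j - lam i * c i * ?A x"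
      unfolding eq[OF x] e by simp
  qed
  note d = this
  show ?thesis
    unfolding has_field_derivative_def
    by (rule has_derivative_transform[OF x _ d[unfolded has_field_derivative_def]]) (rule eq)
qed

definition kernel_matrix :: "real \<Rightarrow> real \<Rightarrow> real ^ 'm ^ 'm" where
  "kernel_matrix v x = (\<chi> i j. passage_kernel x v i j)"

lemma kernel_matrix_row_deriv:
  assumes v: "0 < v" and x: "x \<in> {v..v + a}"
  shows "((\<lambda>x. kernel_matrix v x $ i) has_vector_derivative
     (\<chi> j. decay i * passage_kernel x v i j - lam i * c i * jump_average passage_kernel x v i j)) (at x within {v..v + a})"
  unfolding kernel_matrix_def vec_lambda_beta
  by (intro has_vector_derivative_vec_lambda passage_kernel_deriv assms)

text \<open>The derivative formula has a continuous right-hand side on a compact interval, so every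
  entry is Lipschitz; summing the entrywise constants gives one for the matrix norm.\<close>

lemma AC_kernel_matrix:
  assumes v: "0 < v"
  shows "absolutely_continuous_on_interval v (v + a) (kernel_matrix v)"
proof -
  let ?D = "\<lambda>x i j. decay i * passage_kernel x v i j - lam i * c i * jump_average passage_kernel x v i j"
  have "\<exists>B. \<forall>x\<in>{v..v + a}. \<bar>?D x i j\<bar> \<le> B" for i j
  proof -
    have "continuous_on {v..v + a} (\<lambda>x. passage_kernel x v i j)"
      by (rule DERIV_continuous_on) (rule passage_kernel_deriv[OF v])
    then have "continuous_on {v..v + a} (\<lambda>x. ?D x i j)"
      by (intro continuous_intros continuous_jump_average_section continuous_passage_kernel v)
    then have "bounded ((\<lambda>x. ?D x i j) ` {v..v + a})"
      by (intro compact_imp_bounded compact_continuous_image) simp_all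
    then show ?thesis unfolding bounded_iff by simp
  qed
  then obtain B where B: "\<And>i j x. x \<in> {v..v + a} \<Longrightarrow> \<bar>?D x i j\<bar> \<le> B i j" by metis
  have lip: "\<bar>passage_kernel y v i j - passage_kernel x v i j\<bar> \<le> B i j * (y - x)"
    if "x \<in> {v..v + a}" "y \<in> {v..v + a}" "x \<le> y" for x y i j
    using field_differentiable_bound[OF convex_real_interval(5) passage_kernel_deriv[OF v] _ that(2,1), of i j "B i j"] B that(3)
    by simp
  show ?thesis
  proof (rule AC_lipschitz)
    fix x y assume xy: "x \<in> {v..v + a}" "y \<in> {v..v + a}" "x \<le> y"
    have "norm (kernel_matrix v y - kernel_matrix v x)
        \<le> (\<Sum>i\<in>UNIV. norm ((kernel_matrix v y - kernel_matrix v x) $ i))"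
      unfolding norm_vec_def by (rule L2_set_le_sum) simp
    also have "\<dots> \<le> (\<Sum>i\<in>UNIV. \<Sum>j\<in>UNIV. \<bar>(kernel_matrix v y - kernel_matrix v x) $ i $ j\<bar>)"
      by (intro sum_mono norm_le_l1_cart)
    also have "\<dots> \<le> (\<Sum>i\<in>UNIV. \<Sum>j\<in>UNIV. B i j * (y - x))"
      using lip[OF xy] by (intro sum_mono) (simp add: kernel_matrix_def)
    also have "\<dots> = (\<Sum>i\<in>UNIV. \<Sum>j\<in>UNIV. B i j) * (y - x)" by (simp add: sum_distrib_right)
    finally show "norm (kernel_matrix v y - kernel_matrix v x) \<le> (\<Sum>i\<in>UNIV. \<Sum>j\<in>UNIV. B i j) * (y - x)" .
  qed
qed

text \<open>\<open>F\<close> is prescribed on the interval alone, so that the result applies to the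
  restriction of \<open>kernel_matrix v\<close>, which is \<open>undefined\<close> elsewhere, as
  \<open>bvp_solution\<close> demands.\<close>

lemma solves_bvp_kernel_matrix:
  assumes v: "0 < v" and F: "\<And>x. x \<in> {v..v + a} \<Longrightarrow> F x = kernel_matrix v x"
  shows "solves_bvp c lam p Q w a (H_mat c lam p Q w a) v F"
  unfolding solves_bvp_def
proof (intro conjI)
  have AC: "absolutely_continuous_on_interval v (v + a) F"
  proof (rule AC_cong[OF _ AC_kernel_matrix[OF v]])
    show "kernel_matrix v x = F x" if "x \<in> {v..v + a}" for x using F[OF that] by simp
  qed
  then show "absolutely_continuous_on_interval v (v + a) F" .
  show "bounded (F ` {v..v + a})"
    by (intro compact_imp_bounded compact_continuous_image AC_imp_continuous_on AC) simp
  have "passage_kernel (v + a) v i j = of_bool (i = j)" for i j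
  proof -
    have "(v + a, v) \<in> strip" using v a_pos by (simp add: strip_def)
    from first_jump_passage_kernel[OF this, of i j] show ?thesis by (simp add: first_jump_def)
  qed
  then show "F (v + a) = mat 1"
    using F[of "v + a"] a_pos by (simp add: kernel_matrix_def mat_def vec_eq_iff)
  show "AE x in lborel. x \<in> {v<..<v + a} \<longrightarrow>
       (\<forall>i. \<exists>D. ((\<lambda>y. F y $ i) has_vector_derivative D) (at x) \<and>
          (1 / c i) *\<^sub>R D - (w + lam i) *\<^sub>R (F x $ i)
            + lam i *\<^sub>R (\<Sum>k\<in>UNIV. Q $ i $ k *\<^sub>R
                ((if p i * x < v then H_mat c lam p Q w a (p i * x) else F (p i * x)) $ k)) = 0)"
  proof (intro AE_I2 impI allI)
    fix x i assume x: "x \<in> {v<..<v + a}"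
    let ?D = "\<chi> j. decay i * passage_kernel x v i j - lam i * c i * jump_average passage_kernel x v i j"
    have xI: "x \<in> {v..v + a}" and x0: "0 < x" using x v by auto
    have "((\<lambda>y. kernel_matrix v y $ i) has_vector_derivative ?D) (at x)"
      using has_vector_derivative_within_subset[OF kernel_matrix_row_deriv[OF v xI, of i], of "{v<..<v + a}"] x
      by (simp add: at_within_open[of x "{v<..<v + a}"] greaterThanLessThan_subseteq_atLeastAtMost_iff)
    \<comment> \<open>A derivative at an interior point depends only on values in the open interval,
      where \<open>F\<close> and \<open>kernel_matrix v\<close> agree.\<close>
    then have D: "((\<lambda>y. F y $ i) has_vector_derivative ?D) (at x)"
      by (rule has_vector_derivative_transform_within_open[where S = "{v<..<v + a}"]) (use x F in auto)
    \<comment> \<open>Below \<open>v\<close>, \<open>H_mat\<close> at \<open>p i * x\<close> is the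
      passage transform started on the diagonal, which \<open>passage_transform_eq\<close>
      identifies with the kernel. From \<open>v\<close> on, \<open>p i * x\<close> is still in the
      interval where \<open>F\<close> is known.\<close>
    have "(if p i * x < v then H_mat c lam p Q w a (p i * x) else F (p i * x)) $ k $ j
        = passage_kernel (p i * x) (min v (p i * x)) k j" for k j
    proof (cases "p i * x < v")
      case True
      have "0 < p i * x" using p_pos x0 by simp
      from passage_transform_eq[OF this, of "p i * x" k j] show ?thesis
        using True a_pos by (simp add: H_mat_def)
    next
      case False
      have "p i * x \<le> x" using p_mult_less[OF x0] by (rule less_imp_le)
      then have "p i * x \<le> v + a" using xI by (metis atLeastAtMost_iff order_trans)
      then have "p i * x \<in> {v..v + a}" using False by (metis atLeastAtMost_iff not_less)
      from F[OF this] show ?thesis using False by (simp add: kernel_matrix_def)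
    qed
    then have jump: "(\<Sum>k\<in>UNIV. Q $ i $ k *\<^sub>R
                ((if p i * x < v then H_mat c lam p Q w a (p i * x) else F (p i * x)) $ k)) $ j
        = jump_average passage_kernel x v i j" for j
      by (simp add: sum_component jump_average_def)
    have "(1 / c i) *\<^sub>R ?D - (w + lam i) *\<^sub>R (F x $ i)
            + lam i *\<^sub>R (\<Sum>k\<in>UNIV. Q $ i $ k *\<^sub>R
                ((if p i * x < v then H_mat c lam p Q w a (p i * x) else F (p i * x)) $ k)) = 0"
      unfolding vec_eq_iff
    proof
      fix j
      show "((1 / c i) *\<^sub>R ?D - (w + lam i) *\<^sub>R (F x $ i)
            + lam i *\<^sub>R (\<Sum>k\<in>UNIV. Q $ i $ k *\<^sub>R
                ((if p i * x < v then H_mat c lam p Q w a (p i * x) else F (p i * x)) $ k))) $ j = 0 $ j"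
        unfolding vector_add_component vector_minus_component vector_scaleR_component jump F[OF xI]
        using c_pos[of i] by (simp add: kernel_matrix_def decay_def field_simps)
    qed
    with D show "\<exists>D. ((\<lambda>y. F y $ i) has_vector_derivative D) (at x) \<and>
          (1 / c i) *\<^sub>R D - (w + lam i) *\<^sub>R (F x $ i)
            + lam i *\<^sub>R (\<Sum>k\<in>UNIV. Q $ i $ k *\<^sub>R
                ((if p i * x < v then H_mat c lam p Q w a (p i * x) else F (p i * x)) $ k)) = 0"
      by blast
  qed
qed

lemma F_mat_eq:
  assumes v: "0 < v" and x: "x \<in> {v..v + a}"
  shows "F_mat c lam p Q w a x v = kernel_matrix v x"
proof -
  let ?F = "restrict (kernel_matrix v) {v..v + a}"
  let ?solves = "solves_bvp c lam p Q w a (H_mat c lam p Q w a) v"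
  have F: "?solves ?F" by (rule solves_bvp_kernel_matrix[OF v]) simp
  have "(THE F. F \<in> extensional {v..v + a} \<and> ?solves F) = ?F"
  proof (rule the_equality)
    fix G assume G: "G \<in> extensional {v..v + a} \<and> ?solves G"
    show "G = ?F"
    proof (rule extensionalityI)
      \<comment> \<open>The one-sided comparison of two solutions, used in both directions, gives
        equality on the interval; extensionality settles the remaining points.\<close>
      fix y assume y: "y \<in> {v..v + a}"
      show "G y = ?F y"
        unfolding vec_eq_iff
        by (intro allI antisym bvp_solution_le[OF conjunct2[OF G] F v y] bvp_solution_le[OF F conjunct2[OF G] v y])
    qed (use G in auto)
  qed (use F in simp)
  then show ?thesis using x by (simp add: F_mat_def bvp_solution_def)
qed

end

theorem theorem6p4:
  fixes c lam p :: "'m::finite \<Rightarrow> real" and Q :: "real ^ 'm ^ 'm" and w a :: real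
  assumes "\<And>i. c i > 0" and "\<And>i. lam i > 0" and "\<And>i. 0 < p i \<and> p i < 1"
    and "stochastic_matrix Q"
    and "w > 0" and "a > 0"
  shows "(\<forall>v x i j. 0 < v \<and> v \<le> x \<and> x < v + a \<longrightarrow>
            F_mat c lam p Q w a x v $ i $ j = passage_transform c lam p Q w a x v i j)
       \<and> (\<forall>v>0. F_mat c lam p Q w a v v = H_mat c lam p Q w a v)"
proof -
  interpret drop_process c lam p Q w a
    using assms by unfold_locales
  have *: "F_mat c lam p Q w a x v $ i $ j = passage_transform c lam p Q w a x v i j"
    if "0 < v" "v \<le> x" "x < v + a" for v x i j
    using F_mat_eq[of v x] passage_transform_eq[OF that] that by (simp add: kernel_matrix_def)
  then show ?thesis
    using assms(6) by (auto simp: H_mat_def vec_eq_iff)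
qed

end
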